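(* Let $P=[n_1]+[n_2]+\cdots+[n_k]$ be a disjoint union of chains on $[n]$, $n=n_1+\cdots+n_k$, whose elements are labeled consecutively within chains (the $i$-th chain is $N_i+1\prec N_i+2\prec\cdots\prec N_i+n_i$ with $N_i=n_1+\cdots+n_{i-1}$). Let $M$ be the transition matrix of the promotion graph of $P$ with edge weights given by indeterminates $x_1,\dots,x_n$. Then $$\det(\lambda\mathbb{1}-M)=\lambda\prod_{\substack{\emptyset\subsetneq S\subseteq[n]\\ S\text{ lower set in }P}}(\lambda+x_S)^{\mathfrak{d}_S},$$ where $x_S=\sum_{i\in S}x_i$ and $\mathfrak{d}_S$ is the number of poset derangements of the restriction of $P$ to $S$.
   Context: $\mathcal{L}(P)=\{\pi\in S_n : i\prec j \Rightarrow \pi^{-1}_i<\pi^{-1}_j\}$, in one-line notation $\pi=\pi_1\cdots\pi_n$. $\pi\tau_i$ ($1\le i<n$) swaps $\pi_i,\pi_{i+1}$ if they are incomparable and is $\pi$ otherwise; operators act on the right; $\partial_j=\tau_j\cdots\tau_{n-1}$. Promotion graph: vertices $\mathcal{L}(P)$, an edge $\pi\to\pi\partial_j$ of weight $x_{\pi_j}$ for each $\pi$, $j\in[n]$. Transition matrix $M$: for $\pi'\ne\pi$, $M(\pi',\pi)$ is the sum of weights of edges $\pi\to\pi'$; $M(\pi,\pi)$ is minus the sum of weights of edges $\pi\to\pi'$ with $\pi'\ne\pi$. A lower set $S$ satisfies $x\in S,\ y\preceq x\Rightarrow y\in S$. A poset derangement of a poset $Q$ labeled by $[m]$ is a linear extension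 $\pi$ of $Q$ with $\pi_j\ne j$ for all $j$. For a lower set $S$, the restriction $P|_S$ is relabeled by $[|S|]$ via the unique order-preserving bijection of integer labels $S\to[|S|]$ (it is again a union of chains labeled consecutively within chains), and $\mathfrak{d}_S$ is its number of poset derangements. *)

theory Defs
  imports "Jordan_Normal_Form.Char_Poly" "HOL-Library.List_Lexorder"
begin

text \<open>Elements of posets are the integer labels 1..m; a poset is given by its strict
  order relation lt. Permutations in one-line notation are lists p with
  p ! (i-1) = pi_i.\<close>

definition chain_lt :: "nat list \<Rightarrow> nat \<Rightarrow> nat \<Rightarrow> bool" where
  "chain_lt ns a b \<longleftrightarrow> a < b \<and>
     (\<exists>i<length ns. sum_list (take i ns) < a \<and> b \<le> sum_list (take (Suc i) ns))"

definition linext :: "(nat \<Rightarrow> nat \<Rightarrow> bool) \<Rightarrow> nat \<Rightarrow> nat list set" where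
  "linext lt m = {p. distinct p \<and> set p = {1..m} \<and>
     (\<forall>i<length p. \<forall>j<length p. lt (p ! i) (p ! j) \<longrightarrow> i < j)}"

definition tau :: "(nat \<Rightarrow> nat \<Rightarrow> bool) \<Rightarrow> nat \<Rightarrow> nat list \<Rightarrow> nat list" where
  "tau lt i p = (if 1 \<le> i \<and> i < length p \<and> \<not> lt (p ! (i-1)) (p ! i) \<and> \<not> lt (p ! i) (p ! (i-1))
      then p[i-1 := p ! i, i := p ! (i-1)] else p)"

text \<open>partial_j = tau_j ... tau_{n-1}; acting on the right, tau_j is applied first.\<close>
definition promo :: "(nat \<Rightarrow> nat \<Rightarrow> bool) \<Rightarrow> nat \<Rightarrow> nat list \<Rightarrow> nat list" where
  "promo lt j p = foldl (\<lambda>p i. tau lt i p) p [j..<length p]"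

definition promM :: "(nat \<Rightarrow> nat \<Rightarrow> bool) \<Rightarrow> nat \<Rightarrow> (nat \<Rightarrow> 'a::comm_ring_1) \<Rightarrow> nat list \<Rightarrow> nat list \<Rightarrow> 'a" where
  "promM lt n x q p = (if q \<noteq> p
      then (\<Sum>j\<in>{j\<in>{1..n}. promo lt j p = q}. x (p ! (j-1)))
      else - (\<Sum>j\<in>{j\<in>{1..n}. promo lt j p \<noteq> p}. x (p ! (j-1))))"

text \<open>The transition matrix as a Jordan_Normal_Form matrix, rows/columns indexed by the
  linear extensions in (lexicographic) sorted order; the determinant of lambda*1 - M does
  not depend on this ordering.\<close>
definition promotion_matrix :: "(nat \<Rightarrow> nat \<Rightarrow> bool) \<Rightarrow> nat \<Rightarrow> (nat \<Rightarrow> 'a::comm_ring_1) \<Rightarrow> 'a mat" where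
  "promotion_matrix lt n x =
     (let Ls = sorted_list_of_set (linext lt n)
      in mat (length Ls) (length Ls) (\<lambda>(r, c). promM lt n x (Ls ! r) (Ls ! c)))"

definition lower_set :: "(nat \<Rightarrow> nat \<Rightarrow> bool) \<Rightarrow> nat \<Rightarrow> nat set \<Rightarrow> bool" where
  "lower_set lt n S \<longleftrightarrow> S \<subseteq> {1..n} \<and> (\<forall>a\<in>S. \<forall>b. lt b a \<longrightarrow> b \<in> S)"

definition restr :: "(nat \<Rightarrow> nat \<Rightarrow> bool) \<Rightarrow> nat set \<Rightarrow> nat \<Rightarrow> nat \<Rightarrow> bool" where
  "restr lt S a b \<longleftrightarrow> a \<in> {1..card S} \<and> b \<in> {1..card S} \<and>
     lt (sorted_list_of_set S ! (a-1)) (sorted_list_of_set S ! (b-1))"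

definition poset_derangements :: "(nat \<Rightarrow> nat \<Rightarrow> bool) \<Rightarrow> nat \<Rightarrow> nat list set" where
  "poset_derangements lt m = {p \<in> linext lt m. \<forall>j<m. p ! j \<noteq> Suc j}"

definition num_der :: "(nat \<Rightarrow> nat \<Rightarrow> bool) \<Rightarrow> nat set \<Rightarrow> nat" where
  "num_der lt S = card (poset_derangements (restr lt S) (card S))"

end

theory Submission
  imports Defs "HOL-Combinatorics.Multiset_Permutations"
begin

text \<open>Reading a linear extension as a word in the chain indices, promotion at an element moves the
  corresponding letter to the end. Hence the last r letters of the word evolve autonomously, and
  lumping along these suffixes for successive r peels off the characteristic polynomials of the
  same process on words with fewer letters. With \<chi>(M) the determinant for words of content M,
  b(M, D) the number of letters of which D contains fewer copies than M, and Y(D) the total weight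
  of the top elements of the chains counted by D, this gives
  \<chi>(M) = (z - Y(M)) * (product over D \<subset> M of \<chi>(D) to the power b(M, D) - 1).
  Derangements satisfy the matching recursion: removing fixed points shows that the derangements of
  all D \<subseteq> M together are equinumerous with the words of content M, and these can be counted by
  their first letter.\<close>

text \<open>Adding x_[n] to the diagonal turns the transition matrix into a matrix T that counts
  loops as well. So det(lambda 1 - M) is det(z 1 - T) with z = lambda + x_[n], and z - Y(D) becomes
  lambda + x_S, where the lower set S is the complement of the top elements counted by D. The
  exponent b(M, D) - 1 arises because a suffix of content D has b(M, D) extensions by one letter to
  the left, one of which is spent as the representative of its fibre. When the recursion is
  unrolled, the exponent of z - Y(D) depends on M - D only, which is the content of S; this is how
  derangements of the restriction to S can enter.\<close>

subsection \<open>Determinants indexed by finite sets\<close>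

text \<open>The library version of this lemma assumes an integral domain.\<close>

lemma det_four_block_mat_zero_upper_right:
  fixes A D :: "'a :: comm_ring_1 mat"
  assumes "A \<in> carrier_mat n n" "C \<in> carrier_mat m n" "D \<in> carrier_mat m m"
  shows "det (four_block_mat A (0\<^sub>m n m) C D) = det A * det D"
  using assms
proof (induction n arbitrary: A C)
  case 0
  have "four_block_mat A (0\<^sub>m 0 m) C D = D"
    using 0 by (intro eq_matI) auto
  moreover have "det A = 1"
    using 0 by (simp add: det_def)
  ultimately show ?case by simp
next
  case (Suc n)
  let ?K = "four_block_mat A (0\<^sub>m (Suc n) m) C D"
  have K: "?K \<in> carrier_mat (Suc n + m) (Suc n + m)"
    using Suc.prems by (intro four_block_carrier_mat)
  have minor: "det (mat_delete ?K 0 j) = det (mat_delete A 0 j) * det D" if j: "j < Suc n" for j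
  proof -
    \<comment> \<open>The minor at (0, j) has block form again; column j is lost from A and also
      from the block below it.\<close>
    define C' where "C' = mat m n (\<lambda>(i, k). C $$ (i, if k < j then k else Suc k))"
    have "mat_delete ?K 0 j = four_block_mat (mat_delete A 0 j) (0\<^sub>m n m) C' D"
      using Suc.prems j by (intro eq_matI) (auto simp: mat_delete_def C'_def)
    then show ?thesis
      using Suc.IH[of "mat_delete A 0 j" C'] Suc.prems mat_delete_carrier[of A "Suc n" "Suc n" 0 j]
      by (simp add: C'_def)
  qed
  have "det ?K = (\<Sum>j<Suc n + m. ?K $$ (0, j) * cofactor ?K 0 j)"
    using laplace_expansion_row[OF K, of 0] by simp
  also have "\<dots> = (\<Sum>j<Suc n. ?K $$ (0, j) * cofactor ?K 0 j)"
    using Suc.prems by (intro sum.mono_neutral_right) auto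
  also have "\<dots> = (\<Sum>j<Suc n. A $$ (0, j) * cofactor A 0 j) * det D"
    unfolding sum_distrib_right
    using Suc.prems by (intro sum.cong) (auto simp: cofactor_def minor)
  also have "\<dots> = det A * det D"
    using laplace_expansion_row[OF Suc.prems(1), of 0] by simp
  finally show ?case .
qed

definition det_list :: "'i list \<Rightarrow> ('i \<Rightarrow> 'i \<Rightarrow> 'a) \<Rightarrow> 'a :: comm_ring_1" where
  "det_list xs f = det (mat (length xs) (length xs) (\<lambda>(i, j). f (xs ! i) (xs ! j)))"

text \<open>Rows and columns are permuted by the same permutation, so its sign enters twice and
  cancels. The column permutation is carried out on the transpose.\<close>

lemma det_list_mset_cong:
  assumes "mset xs = mset ys"
  shows "det_list xs f = det_list ys f"
proof -
  let ?n = "length ys"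
  obtain p where p: "p permutes {..<?n}" and xs: "permute_list p ys = xs"
    using mset_eq_permutation[OF assms] by blast
  have len: "length xs = ?n"
    using assms by (rule mset_eq_length)
  have p': "p permutes {0..<?n}"
    using p by (simp add: atLeast0LessThan)
  define A where "A = mat ?n ?n (\<lambda>(i, j). f (ys ! i) (ys ! j))"
  define B where "B = mat ?n ?n (\<lambda>(i, j). A $$ (p i, j))"
  have less: "p i < ?n" if "i < ?n" for i
    using permutes_in_image[OF p, of i] that by simp
  have A: "A \<in> carrier_mat ?n ?n" and B: "B \<in> carrier_mat ?n ?n" "transpose_mat B \<in> carrier_mat ?n ?n"
    by (auto simp: A_def B_def)
  have "mat ?n ?n (\<lambda>(i, j). f (xs ! i) (xs ! j)) =
      transpose_mat (mat ?n ?n (\<lambda>(i, j). transpose_mat B $$ (p i, j)))"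
    using p by (intro eq_matI) (auto simp: A_def B_def less xs[symmetric] permute_list_nth)
  then have "det_list xs f = det (mat ?n ?n (\<lambda>(i, j). transpose_mat B $$ (p i, j)))"
    unfolding det_list_def len by (simp add: det_transpose[of _ ?n])
  also have "\<dots> = signof p * (signof p * det A)"
    using det_permute_rows[OF B(2) p'] det_permute_rows[OF A p'] det_transpose[OF B(1)]
    by (simp add: B_def)
  also have "\<dots> = det A"
    by (simp add: sign_def)
  finally show ?thesis
    by (simp add: A_def det_list_def)
qed

lemma det_list_map: "det_list (map h xs) f = det_list xs (\<lambda>i j. f (h i) (h j))"
  unfolding det_list_def by (rule arg_cong[of _ _ det]) (auto intro!: eq_matI)

lemma det_list_cong:
  assumes "\<And>i j. i \<in> set xs \<Longrightarrow> j \<in> set xs \<Longrightarrow> f i j = g i j"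
  shows "det_list xs f = det_list xs g"
  unfolding det_list_def using assms by (intro arg_cong[of _ _ det] eq_matI) auto

lemma det_list_append:
  assumes "\<And>i j. i \<in> set xs \<Longrightarrow> j \<in> set ys \<Longrightarrow> f i j = 0"
  shows "det_list (xs @ ys) f = det_list xs f * det_list ys f"
proof -
  let ?m = "\<lambda>us vs. mat (length us) (length vs) (\<lambda>(i, j). f (us ! i) (vs ! j))"
  have "?m (xs @ ys) (xs @ ys) =
      four_block_mat (?m xs xs) (0\<^sub>m (length xs) (length ys)) (?m ys xs) (?m ys ys)"
    using assms by (intro eq_matI) (auto simp: nth_append)
  then show ?thesis
    unfolding det_list_def by (simp add: det_four_block_mat_zero_upper_right)
qed

lemma det_list_mult:
  assumes "distinct xs"
  shows "det_list xs f * det_list xs g = det_list xs (\<lambda>i j. \<Sum>k\<in>set xs. f i k * g k j)"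
proof -
  let ?n = "length xs"
  let ?m = "\<lambda>h. mat ?n ?n (\<lambda>(i, j). h (xs ! i) (xs ! j))"
  have "?m f * ?m g = ?m (\<lambda>i j. \<Sum>k\<in>set xs. f i k * g k j)"
  proof (intro eq_matI)
    fix i j assume "i < dim_row (?m (\<lambda>i j. \<Sum>k\<in>set xs. f i k * g k j))"
      "j < dim_col (?m (\<lambda>i j. \<Sum>k\<in>set xs. f i k * g k j))"
    then show "(?m f * ?m g) $$ (i, j) = ?m (\<lambda>i j. \<Sum>k\<in>set xs. f i k * g k j) $$ (i, j)"
      using sum.reindex_bij_betw[OF bij_betw_nth[OF assms refl refl],
          of "\<lambda>k. f (xs ! i) k * g k (xs ! j)"]
      by (simp add: scalar_prod_def atLeast0LessThan)
  qed auto
  then show ?thesis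
    unfolding det_list_def by (subst det_mult[symmetric, of _ ?n]) auto
qed

text \<open>The blocks of the matrix are sets of words that get united, split and reindexed; an
  arbitrary enumeration keeps orderings out of these arguments.\<close>

definition det_set :: "'i set \<Rightarrow> ('i \<Rightarrow> 'i \<Rightarrow> 'a) \<Rightarrow> 'a :: comm_ring_1" where
  "det_set X f = det_list (SOME xs. distinct xs \<and> set xs = X) f"

lemma det_set_eq_det_list:
  assumes "distinct xs" "set xs = X"
  shows "det_set X f = det_list xs f"
proof -
  have "distinct (SOME xs. distinct xs \<and> set xs = X) \<and> set (SOME xs. distinct xs \<and> set xs = X) = X"
    by (rule someI[of _ xs]) (use assms in simp)
  then show ?thesis
    unfolding det_set_def using assms
    by (intro det_list_mset_cong) (simp add: set_eq_iff_mset_eq_distinct[symmetric])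
qed

lemma det_set_reindex:
  assumes "bij_betw h X Y" "finite X"
  shows "det_set Y f = det_set X (\<lambda>i j. f (h i) (h j))"
proof -
  obtain xs where xs: "set xs = X" "distinct xs"
    using finite_distinct_list[OF assms(2)] by blast
  have "distinct (map h xs)" "set (map h xs) = Y"
    using assms xs by (auto simp: distinct_map bij_betw_def)
  then show ?thesis
    using xs by (simp add: det_set_eq_det_list[of "map h xs" Y] det_set_eq_det_list[of xs X] det_list_map)
qed

lemma det_set_cong:
  assumes "X = Y" "finite X" "\<And>i j. i \<in> X \<Longrightarrow> j \<in> X \<Longrightarrow> f i j = g i j"
  shows "det_set X f = det_set Y g"
proof -
  obtain xs where xs: "set xs = X" "distinct xs"
    using finite_distinct_list[OF assms(2)] by blast
  show ?thesis
    using xs assms by (auto simp: det_set_eq_det_list[of xs] intro!: det_list_cong)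
qed

lemma det_set_empty [simp]: "det_set {} f = 1"
  by (simp add: det_set_eq_det_list[of "[]"] det_list_def det_def)

lemma det_set_singleton [simp]: "det_set {i} f = f i i"
  by (simp add: det_set_eq_det_list[of "[i]"] det_list_def det_def)

lemma det_set_Un:
  assumes "finite X" "finite Y" "X \<inter> Y = {}" "\<And>i j. i \<in> X \<Longrightarrow> j \<in> Y \<Longrightarrow> f i j = 0"
  shows "det_set (X \<union> Y) f = det_set X f * det_set Y f"
proof -
  obtain xs ys where xs: "set xs = X" "distinct xs" and ys: "set ys = Y" "distinct ys"
    using finite_distinct_list[OF assms(1)] finite_distinct_list[OF assms(2)] by blast
  have "det_list (xs @ ys) f = det_list xs f * det_list ys f"
    using assms(4) xs(1) ys(1) by (intro det_list_append) blast
  then show ?thesis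
    using xs ys assms(3)
    by (simp add: det_set_eq_det_list[of xs X] det_set_eq_det_list[of ys Y]
        det_set_eq_det_list[of "xs @ ys" "X \<union> Y"])
qed

lemma det_set_mult:
  assumes "finite X"
  shows "det_set X f * det_set X g = det_set X (\<lambda>i j. \<Sum>k\<in>X. f i k * g k j)"
proof -
  obtain xs where xs: "set xs = X" "distinct xs"
    using finite_distinct_list[OF assms(1)] by blast
  then show ?thesis
    using det_list_mult[of xs f g] by (simp add: det_set_eq_det_list[of xs])
qed

lemma det_set_diag:
  assumes "finite X" "\<And>i j. i \<in> X \<Longrightarrow> j \<in> X \<Longrightarrow> f i j = (if i = j then 1 else 0)"
  shows "det_set X f = 1"
  using assms
proof (induction X rule: finite_induct)
  case (insert i X)
  have "det_set ({i} \<union> X) f = det_set {i} f * det_set X f"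
    using insert.hyps insert.prems by (intro det_set_Un) auto
  then show ?case
    using insert by simp
qed simp

lemma det_set_UN:
  assumes "finite T" "\<And>t. t \<in> T \<Longrightarrow> finite (X t)"
    and "\<And>t u i j. t \<in> T \<Longrightarrow> u \<in> T \<Longrightarrow> t \<noteq> u \<Longrightarrow> i \<in> X t \<Longrightarrow> j \<in> X u \<Longrightarrow> i \<noteq> j \<and> f i j = 0"
  shows "det_set (\<Union>t\<in>T. X t) f = (\<Prod>t\<in>T. det_set (X t) f)"
  using assms
proof (induction T rule: finite_induct)
  case (insert t T)
  have "det_set (X t \<union> (\<Union>t\<in>T. X t)) f = det_set (X t) f * det_set (\<Union>t\<in>T. X t) f"
  proof (rule det_set_Un)
    show "finite (X t)" "finite (\<Union>t\<in>T. X t)"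
      using insert.hyps insert.prems(1) by auto
    show "X t \<inter> (\<Union>t\<in>T. X t) = {}"
      using insert.hyps insert.prems(2)[of t] by blast
    show "f i j = 0" if "i \<in> X t" "j \<in> (\<Union>t\<in>T. X t)" for i j
      using that insert.hyps insert.prems(2)[of t] by blast
  qed
  moreover have "det_set (\<Union>t\<in>T. X t) f = (\<Prod>t\<in>T. det_set (X t) f)"
    using insert.prems by (intro insert.IH) blast+
  ultimately show ?case using insert.hyps by simp
qed simp

text \<open>If K is lumpable along \<pi>, the block of the quotient L splits off: add to the row of each
  representative s y the rows of its fibre, then subtract the column of s (\<pi> x) from that of x.\<close>

lemma det_set_lump:
  assumes X: "finite X" and \<pi>: "\<pi> ` X \<subseteq> Y"
    and s: "\<And>y. y \<in> Y \<Longrightarrow> s y \<in> X \<and> \<pi> (s y) = y"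
    and lump: "\<And>x y. x \<in> X \<Longrightarrow> y \<in> Y \<Longrightarrow> (\<Sum>x'\<in>{x'\<in>X. \<pi> x' = y}. K x' x) = L y (\<pi> x)"
  shows "det_set X K = det_set Y L * det_set (X - s ` Y) (\<lambda>x' x. K x' x - K x' (s (\<pi> x)))"
proof -
  define S where "S = s ` Y"
  define Z where "Z = X - S"
  have S: "finite S" "S \<subseteq> X" and Z: "finite Z" and XSZ: "X = S \<union> Z" "S \<inter> Z = {}"
    using X s finite_subset[of S X] unfolding S_def Z_def by auto
  have \<pi>S: "\<pi> x \<in> Y" "s (\<pi> x) = x" if "x \<in> S" for x
    using that s unfolding S_def by auto
  have \<pi>X: "\<pi> x \<in> Y" "s (\<pi> x) \<in> S" "\<pi> (s (\<pi> x)) = \<pi> x" if "x \<in> X" for x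
    using that \<pi> s unfolding S_def by auto
  have notZ: "i \<notin> Z" if "i \<in> S" for i using that XSZ(2) by blast
  \<comment> \<open>\<open>P\<close> is the row operation and \<open>Q\<close> the column operation;
    both are unitriangular once \<open>Z\<close> is listed before \<open>S\<close>.\<close>
  define P :: "'a \<Rightarrow> 'a \<Rightarrow> 'c" where
    "P i j = (if i \<in> S then (if \<pi> j = \<pi> i then 1 else 0) else (if i = j then 1 else 0))" for i j
  define Q :: "'a \<Rightarrow> 'a \<Rightarrow> 'c" where
    "Q i j = (if i = j then 1 else 0) - (if j \<in> Z \<and> i = s (\<pi> j) then 1 else 0)" for i j
  have eqS: "\<pi> i = \<pi> j \<longleftrightarrow> i = j" if "i \<in> S" "j \<in> S" for i j
    using arg_cong[of "\<pi> i" "\<pi> j" s] \<pi>S(2)[OF that(1)] \<pi>S(2)[OF that(2)] by metis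
  have detP: "det_set X P = 1"
  proof -
    have "det_set (Z \<union> S) P = det_set Z P * det_set S P"
      using S(1) Z XSZ(2) by (intro det_set_Un) (auto simp: P_def)
    also have "\<dots> = 1"
    proof -
      have "det_set Z P = 1"
        using Z notZ by (intro det_set_diag) (auto simp: P_def)
      moreover have "det_set S P = 1"
        using S(1) by (intro det_set_diag) (auto simp: P_def eqS)
      ultimately show ?thesis by simp
    qed
    finally show ?thesis using XSZ(1) by (simp add: Un_commute)
  qed
  have detQ: "det_set X Q = 1"
  proof -
    have "det_set (Z \<union> S) Q = det_set Z Q * det_set S Q"
      using S(1) Z XSZ(2) \<pi>X(2) by (intro det_set_Un) (auto simp: Q_def)
    also have "\<dots> = 1"
    proof -
      have "det_set Z Q = 1"
        using Z notZ \<pi>X(2) by (intro det_set_diag) (auto simp: Q_def Z_def)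
      moreover have "det_set S Q = 1"
        using S(1) notZ by (intro det_set_diag) (auto simp: Q_def)
      ultimately show ?thesis by simp
    qed
    finally show ?thesis using XSZ(1) by (simp add: Un_commute)
  qed
  define R where "R i j = (\<Sum>k\<in>X. P i k * K k j)" for i j
  define T where "T i j = (\<Sum>k\<in>X. R i k * Q k j)" for i j
  have R: "R i j = (if i \<in> S then L (\<pi> i) (\<pi> j) else K i j)" if "i \<in> X" "j \<in> X" for i j
  proof (cases "i \<in> S")
    case True
    have "R i j = (\<Sum>k\<in>X. if \<pi> k = \<pi> i then K k j else 0)"
      unfolding R_def P_def using True by (intro sum.cong) auto
    also have "\<dots> = (\<Sum>k\<in>{k\<in>X. \<pi> k = \<pi> i}. K k j)"
      using X by (simp add: sum.If_cases Collect_conj_eq)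
    finally show ?thesis using lump[of j "\<pi> i"] that True \<pi>S by simp
  next
    case False
    have "R i j = (\<Sum>k\<in>X. if i = k then K k j else 0)"
      unfolding R_def P_def using False by (intro sum.cong) auto
    then show ?thesis using X that False by simp
  qed
  have T: "T i j = R i j - (if j \<in> Z then R i (s (\<pi> j)) else 0)" if "i \<in> X" "j \<in> X" for i j
  proof -
    have "T i j = (\<Sum>k\<in>X. (if k = j then R i k else 0) -
        (if k = s (\<pi> j) then if j \<in> Z then R i k else 0 else 0))"
      unfolding T_def Q_def by (intro sum.cong) auto
    then show ?thesis using X that \<pi>X[of j] S
      by (auto simp: sum_subtractf)
  qed
  \<comment> \<open>By lumpability the new row of a representative depends on the column j only
    through \<open>\<pi> j\<close>, so subtracting the column of \<open>s (\<pi> j)\<close> clears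
    it on \<open>Z\<close>. This is the zero block.\<close>
  have TX: "T i j = (if i \<in> S then if j \<in> S then L (\<pi> i) (\<pi> j) else 0
      else if j \<in> S then K i j else K i j - K i (s (\<pi> j)))" if "i \<in> X" "j \<in> X" for i j
    using that \<pi>X[OF that(2)] S by (auto simp: T R Z_def)
  have "det_set X K = det_set X P * det_set X K * det_set X Q"
    by (simp add: detP detQ)
  also have "\<dots> = det_set X T"
    using X by (simp add: det_set_mult R_def[abs_def] T_def[abs_def])
  also have "\<dots> = det_set S T * det_set Z T"
    unfolding XSZ(1) using S Z XSZ by (intro det_set_Un) (auto simp: TX notZ)
  also have "det_set S T = det_set Y (\<lambda>i j. T (s i) (s j))"
  proof (rule det_set_reindex)
    show "bij_betw s Y S"
      unfolding S_def by (rule bij_betw_byWitness[where f' = \<pi>]) (use s in auto)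
    then show "finite Y"
      using S bij_betw_finite by blast
  qed
  also have "\<dots> = det_set Y L"
  proof (rule det_set_cong[OF refl])
    show "finite Y"
      using finite_subset[of Y "\<pi> ` S"] S s unfolding S_def by force
    show "T (s i) (s j) = L i j" if "i \<in> Y" "j \<in> Y" for i j
      using that s by (subst TX) (auto simp: S_def)
  qed
  also have "det_set Z T = det_set Z (\<lambda>x' x. K x' x - K x' (s (\<pi> x)))"
    using Z by (intro det_set_cong) (auto simp: TX Z_def)
  finally show ?thesis
    by (simp add: Z_def S_def)
qed

subsection \<open>The promotion chain on words\<close>

text \<open>The poset elements behind the content M, with t counted from the top of chain c. Hence
  \<open>elems D\<close> for \<open>D \<subseteq># M\<close> is an upper set, whatever M is.\<close>

definition elems :: "'b multiset \<Rightarrow> ('b \<times> nat) set" where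
  "elems M = {(c, t). t < count M c}"

lemma elems_iff: "(c, t) \<in> elems M \<longleftrightarrow> t < count M c"
  by (simp add: elems_def)

lemma elems_Sigma: "elems M = (SIGMA c:set_mset M. {..<count M c})"
  by (auto simp: elems_def) (use count_inI gr_implies_not0 in fastforce)

lemma finite_elems [simp]: "finite (elems M)"
  by (simp add: elems_Sigma)

lemma card_elems: "card (elems M) = size M"
  by (simp add: elems_Sigma size_multiset_overloaded_eq)

lemma elems_mono: "D \<subseteq># M \<Longrightarrow> elems D \<subseteq> elems M"
  by (auto simp: elems_def subseteq_mset_def intro: less_le_trans)

lemma elems_empty [simp]: "elems {#} = {}"
  by (simp add: elems_def)

lemma elems_add_mset: "elems (add_mset b M) = insert (b, count M b) (elems M)"
  by (auto simp: elems_def less_Suc_eq split: if_splits)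

lemma add_mset_subseteq_iff: "add_mset b D \<subseteq># M \<longleftrightarrow> D \<subseteq># M \<and> b \<in># M - D"
proof
  assume "add_mset b D \<subseteq># M"
  moreover from this have "count (add_mset b D) b \<le> count M b"
    by (rule mset_subset_eq_count)
  ultimately show "D \<subseteq># M \<and> b \<in># M - D"
    using subset_mset.trans[of D "add_mset b D" M] by (simp add: in_diff_count Suc_le_eq)
next
  assume "D \<subseteq># M \<and> b \<in># M - D"
  then show "add_mset b D \<subseteq># M"
    by (auto simp: subseteq_mset_def in_diff_count Suc_le_eq)
qed

lemma finite_submultisets [simp]: "finite {D. D \<subseteq># M}"
proof (rule finite_surj)
  show "finite (Pow (elems M))" by simp
  have "D = Abs_multiset (\<lambda>c. card {t. (c, t) \<in> elems D})" for D :: "'a multiset"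
    by (simp add: elems_def)
  then show "{D. D \<subseteq># M} \<subseteq> (\<lambda>A. Abs_multiset (\<lambda>c. card {t. (c, t) \<in> A})) ` Pow (elems M)"
    using elems_mono[of _ M] by blast
qed

lemma finite_proper_submultisets [simp]: "finite {D. D \<subset># M}"
  by (rule finite_subset[OF _ finite_submultisets[of M]]) (auto simp: subset_mset.less_imp_le)

text \<open>A linear extension of a disjoint union of chains is encoded by the word of its chain indices,
  and the element (c, t) is the occurrence of the letter c that has exactly t further occurrences
  of c to its right. Promotion at this element moves it to the end of the word; because positions
  within a letter are counted from the right, this makes sense for a mere suffix of the word
  too: if the element lies to the left of the suffix, or is its first letter, the suffix loses
  its first letter.\<close>

fun act :: "'b \<times> nat \<Rightarrow> 'b list \<Rightarrow> 'b list" where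
  "act _ [] = []"
| "act e (b # u) = (if snd e < count (mset u) (fst e) then b # act e u else u @ [fst e])"

lemma length_act [simp]: "length (act e v) = length v"
  by (induction v) auto

lemma mset_act: "snd e < count (mset v) (fst e) \<Longrightarrow> mset (act e v) = mset v"
  by (induction v) (auto split: if_splits)

lemma act_snoc: "count (mset v) (fst e) \<le> snd e \<Longrightarrow> act e v = tl (v @ [fst e])"
  by (cases v) (auto split: if_splits)

text \<open>This is the autonomy of suffixes: occurrences are counted from the right, so deleting
  the first letter renames no element.\<close>

lemma tl_act: "tl (act e v) = act e (tl v)"
  by (cases v) (auto simp: act_snoc not_less split: if_splits)

section \<open>Suffix processes and the recursion for the determinant\<close>

definition suffixes :: "'b multiset \<Rightarrow> nat \<Rightarrow> 'b list set" where
  "suffixes M r = {v. length v = r \<and> mset v \<subseteq># M}"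

lemma finite_suffixes [simp]: "finite (suffixes M r)"
proof (rule finite_subset)
  show "suffixes M r \<subseteq> {v. set v \<subseteq> set_mset M \<and> length v = r}"
    unfolding suffixes_def by (auto dest: mset_subset_eqD)
qed (simp add: finite_lists_length_eq)

lemma suffixes_0 [simp]: "suffixes M 0 = {[]}"
  by (auto simp: suffixes_def)

lemma suffixes_size: "suffixes M (size M) = permutations_of_multiset M"
proof -
  have "mset v = M" if "mset v \<subseteq># M" "length v = size M" for v
    using that mset_subset_size[of "mset v" M] by (auto simp: subset_mset.le_less)
  then show ?thesis
    by (auto simp: suffixes_def permutations_of_multiset_def)
qed

lemma tl_suffixes: "v \<in> suffixes M (Suc r) \<Longrightarrow> tl v \<in> suffixes M r"
  by (cases v) (auto simp: suffixes_def add_mset_subseteq_iff)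

lemma act_suffixes:
  assumes e: "e \<in> elems M" and v: "v \<in> suffixes M r"
  shows "act e v \<in> suffixes M r"
proof (cases "snd e < count (mset v) (fst e)")
  case True
  then show ?thesis
    using v by (simp add: suffixes_def mset_act)
next
  case False
  obtain c t where ct: "e = (c, t)" by force
  have "count (mset v) c < count M c"
    using e False by (auto simp: elems_def ct)
  then have "add_mset c (mset v) \<subseteq># M"
    using v by (auto simp: suffixes_def subseteq_mset_def)
  moreover have "mset (tl (v @ [c])) \<subseteq># add_mset c (mset v)"
    by (cases v) auto
  ultimately show ?thesis
    using v False act_snoc[of v e] by (auto simp: suffixes_def ct)
qed

text \<open>Loops are counted, so each column over suffixes sums to Y(M). The content of v may be
  smaller than M: elements lying to the left of v act too.\<close>

definition trans_wt :: "('b \<times> nat \<Rightarrow> 'a) \<Rightarrow> 'b multiset \<Rightarrow> 'b list \<Rightarrow> 'b list \<Rightarrow> 'a :: comm_ring_1" where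
  "trans_wt y M v' v = (\<Sum>e\<in>elems M. if act e v = v' then y e else 0)"

definition word_det :: "'a \<Rightarrow> ('b \<times> nat \<Rightarrow> 'a) \<Rightarrow> 'b multiset \<Rightarrow> 'a :: comm_ring_1" where
  "word_det z y M = det_set (permutations_of_multiset M)
     (\<lambda>v' v. (if v' = v then z else 0) - trans_wt y M v' v)"

text \<open>Interpolates between the empty suffix, where only z - Y(M) is left, and whole words,
  where it is \<open>word_det\<close>.\<close>

definition suffix_det :: "'a \<Rightarrow> ('b \<times> nat \<Rightarrow> 'a) \<Rightarrow> 'b multiset \<Rightarrow> nat \<Rightarrow> 'a :: comm_ring_1" where
  "suffix_det z y M r = det_set (suffixes M r)
     (\<lambda>v' v. (if v' = v then z else 0) - trans_wt y M v' v)"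

lemma trans_wt_restrict:
  assumes "D \<subseteq># M" "mset v = D"
  shows "(\<Sum>e\<in>elems M. if snd e < count D (fst e) \<and> act e v = v' then y e else 0) = trans_wt y D v' v"
proof -
  have "trans_wt y D v' v =
      (\<Sum>e\<in>elems D. if snd e < count D (fst e) \<and> act e v = v' then y e else 0)"
    unfolding trans_wt_def by (intro sum.cong) (auto simp: elems_def)
  also have "\<dots> = (\<Sum>e\<in>elems M. if snd e < count D (fst e) \<and> act e v = v' then y e else 0)"
    using elems_mono[OF assms(1)] by (intro sum.mono_neutral_left) (auto simp: elems_iff)
  finally show ?thesis by simp
qed

text \<open>By \<open>tl_act\<close> an element moves v into the fibre over \<open>u'\<close>
  exactly when it moves \<open>tl v\<close> to \<open>u'\<close>. This is the lumpability demanded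
  by \<open>det_set_lump\<close>.\<close>

lemma trans_wt_lump:
  assumes v: "v \<in> suffixes M (Suc r)"
  shows "(\<Sum>v'\<in>{v'\<in>suffixes M (Suc r). tl v' = u'}. trans_wt y M v' v) = trans_wt y M u' (tl v)"
proof -
  let ?V = "{v'\<in>suffixes M (Suc r). tl v' = u'}"
  have "(\<Sum>v'\<in>?V. trans_wt y M v' v) = (\<Sum>e\<in>elems M. \<Sum>v'\<in>?V. if act e v = v' then y e else 0)"
    unfolding trans_wt_def by (rule sum.swap)
  also have "\<dots> = trans_wt y M u' (tl v)"
    unfolding trans_wt_def
    using act_suffixes[OF _ v] by (intro sum.cong refl) (auto simp: tl_act[symmetric])
  finally show ?thesis .
qed

text \<open>Lump suffixes of length r + 1 by deleting the first letter, with g (mset u) # u representing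
  the fibre over u. On the remaining words b # u the contributions in which the first letter is
  lost cancel, and what is left fixes b and acts on u like the full chain on words of content
  mset u.\<close>

lemma suffix_det_Suc:
  assumes r: "r < size M"
  shows "suffix_det z y M (Suc r) = suffix_det z y M r *
    (\<Prod>D\<in>{D. D \<subseteq># M \<and> size D = r}. word_det z y D ^ (card (set_mset (M - D)) - 1))"
proof -
  define g where "g D = (SOME b. b \<in># M - D)" for D
  have g: "g D \<in># M - D" if "D \<subseteq># M" "size D = r" for D
  proof -
    have "M - D \<noteq> {#}"
      using that r size_Diff_submset[of D M] by auto
    then show ?thesis
      unfolding g_def by (metis multiset_nonemptyE someI_ex)
  qed
  let ?K = "\<lambda>v' v. (if v' = v then z else 0) - trans_wt y M v' v"
  let ?s = "\<lambda>u. g (mset u) # u"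
  let ?C = "\<lambda>v' v. ?K v' v - ?K v' (?s (tl v))"
  let ?DD = "{D. D \<subseteq># M \<and> size D = r}"
  \<comment> \<open>An index is the content of a tail together with a first letter that does not
    mark the representative; each D has b(M, D) - 1 of these.\<close>
  let ?I = "SIGMA D:?DD. set_mset (M - D) - {g D}"
  let ?X = "\<lambda>(D, b). Cons b ` permutations_of_multiset D"
  have finDD: "finite ?DD"
    by (rule finite_subset[OF _ finite_submultisets[of M]]) auto
  have C: "?C (b' # u') (b # u) = (if b' = b then (if u' = u then z else 0) - trans_wt y (mset u) u' u else 0)"
    if D: "mset u \<subseteq># M" "b' \<noteq> g (mset u')" "b \<noteq> g (mset u)" for b b' u u'
  proof -
    let ?D = "mset u"
    have "trans_wt y M (b' # u') (b # u) - trans_wt y M (b' # u') (g ?D # u) =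
        (\<Sum>e\<in>elems M. if b' = b then if snd e < count ?D (fst e) \<and> act e u = u' then y e else 0 else 0)"
      unfolding trans_wt_def sum_subtractf[symmetric]
    \<comment> \<open>If e lies in u, the second term vanishes: \<open>act\<close> keeps the content
      of u, so \<open>b'\<close> would be the letter marking the representative. Otherwise both
      columns lead to \<open>u @ [fst e]\<close> and cancel.\<close>
    proof (intro sum.cong refl)
      fix e
      show "(if act e (b # u) = b' # u' then y e else 0) - (if act e (g ?D # u) = b' # u' then y e else 0) =
          (if b' = b then if snd e < count ?D (fst e) \<and> act e u = u' then y e else 0 else 0)"
        using D mset_act[of e u] by auto
    qed
    also have "\<dots> = (if b' = b then trans_wt y ?D u' u else 0)"
      using trans_wt_restrict[OF D(1) refl, of u' y] by simp
    finally show ?thesis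
      using D by (auto simp: algebra_simps)
  qed
  have "suffix_det z y M (Suc r) = det_set (suffixes M r) ?K *
      det_set (suffixes M (Suc r) - ?s ` suffixes M r) ?C"
    unfolding suffix_det_def
  proof (rule det_set_lump)
    show "tl ` suffixes M (Suc r) \<subseteq> suffixes M r"
      using tl_suffixes by blast
    show "?s u \<in> suffixes M (Suc r) \<and> tl (?s u) = u" if "u \<in> suffixes M r" for u
      using that g[of "mset u"] by (simp add: suffixes_def add_mset_subseteq_iff)
    show "(\<Sum>v'\<in>{v'\<in>suffixes M (Suc r). tl v' = u'}. ?K v' v) = ?K u' (tl v)"
      if "v \<in> suffixes M (Suc r)" "u' \<in> suffixes M r" for v u'
    proof -
      have "(\<Sum>v'\<in>{v'\<in>suffixes M (Suc r). tl v' = u'}. if v' = v then z else 0) =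
          (if u' = tl v then z else 0)"
        using that by (auto simp: sum.If_cases)
      then show ?thesis
        by (simp add: sum_subtractf trans_wt_lump[OF that(1)])
    qed
  qed simp
  also have "det_set (suffixes M (Suc r) - ?s ` suffixes M r) ?C = det_set (\<Union>i\<in>?I. ?X i) ?C"
  proof (rule arg_cong[of _ _ "\<lambda>X. det_set X ?C"], intro equalityI subsetI)
    fix v assume v: "v \<in> suffixes M (Suc r) - ?s ` suffixes M r"
    then obtain b u where [simp]: "v = b # u"
      by (cases v) (auto simp: suffixes_def)
    have "u \<in> suffixes M r" "mset u \<in> ?DD" "b \<in># M - mset u" "b \<noteq> g (mset u)"
      using v by (auto simp: suffixes_def add_mset_subseteq_iff)
    then have "(mset u, b) \<in> ?I" "v \<in> ?X (mset u, b)"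
      by (auto simp: permutations_of_multiset_def)
    then show "v \<in> (\<Union>i\<in>?I. ?X i)" by blast
  next
    fix v assume "v \<in> (\<Union>i\<in>?I. ?X i)"
    then show "v \<in> suffixes M (Suc r) - ?s ` suffixes M r"
      by (auto simp: suffixes_def add_mset_subseteq_iff permutations_of_multiset_def)
  qed
  also have "\<dots> = (\<Prod>i\<in>?I. det_set (?X i) ?C)"
  \<comment> \<open>The first letter and the content of the tail are both conserved, so the
    remaining matrix is block diagonal.\<close>
  proof (rule det_set_UN)
    show "finite ?I"
      using finDD by auto
    show "finite (?X i)" for i
      by (cases i) simp
    show "i \<noteq> j \<and> ?C i j = 0" 
      if "t \<in> ?I" "t' \<in> ?I" "t \<noteq> t'" "i \<in> ?X t" "j \<in> ?X t'" for t t' i j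
    proof -
      obtain D b D' b' where t: "t = (D, b)" "t' = (D', b')"
        by (metis surj_pair)
      with that obtain u u' where u: "i = b # u" "mset u = D" "j = b' # u'" "mset u' = D'"
        by (auto simp: permutations_of_multiset_def)
      have "?C i j = (if b = b' then (if u = u' then z else 0) - trans_wt y (mset u') u u' else 0)"
        using C[of u' b u b'] that(1,2) u by (auto simp: t)
      moreover have "trans_wt y (mset u') u u' = 0" if "mset u \<noteq> mset u'"
        unfolding trans_wt_def using that mset_act[of _ u']
        by (intro sum.neutral) (auto simp: elems_def)
      ultimately show ?thesis
        using that(3) u t by auto
    qed
  qed
  also have "\<dots> = (\<Prod>(D, b)\<in>?I. word_det z y D)"
  proof (rule prod.cong[OF refl])
    fix i assume "i \<in> ?I"
    then obtain D b where i: "i = (D, b)"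
      and D: "D \<subseteq># M" "r = size D" and b: "b \<in># M - D" "b \<noteq> g D"
      by blast
    have "det_set (Cons b ` permutations_of_multiset D) ?C =
        det_set (permutations_of_multiset D) (\<lambda>v' v. ?C (b # v') (b # v))"
      by (rule det_set_reindex) (auto simp: bij_betw_def inj_on_def)
    also have "\<dots> = word_det z y D"
      unfolding word_det_def
    proof (rule det_set_cong)
      fix v' v assume "v' \<in> permutations_of_multiset D" "v \<in> permutations_of_multiset D"
      then have "mset v' = D" "mset v = D"
        by (auto simp: permutations_of_multiset_def)
      then show "?C (b # v') (b # v) = (if v' = v then z else 0) - trans_wt y D v' v"
        using C[of v b v' b] D b by simp
    qed auto
    finally show "det_set (?X i) ?C = (case i of (D, b) \<Rightarrow> word_det z y D)"
      by (simp add: i)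
  qed
  also have "\<dots> = (\<Prod>D\<in>?DD. word_det z y D ^ (card (set_mset (M - D)) - 1))"
    using finDD g by (subst prod.Sigma[symmetric]) (auto simp: prod_constant)
  finally show ?thesis
    by (simp add: suffix_det_def)
qed

text \<open>The lumping steps for all r below \<open>size M\<close> multiply up; r is the size of D,
  so every proper D occurs once. The leading factor belongs to the one-state process on the empty
  suffix.\<close>

lemma word_det_rec:
  "word_det z y M = (z - sum y (elems M)) *
    (\<Prod>D\<in>{D. D \<subset># M}. word_det z y D ^ (card (set_mset (M - D)) - 1))"
proof -
  define F where "F D = word_det z y D ^ (card (set_mset (M - D)) - 1)" for D
  have "suffix_det z y M r = (z - sum y (elems M)) * (\<Prod>D\<in>{D. D \<subseteq># M \<and> size D < r}. F D)"
    if "r \<le> size M" for r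
    using that
  proof (induction r)
    case 0
    then show ?case by (simp add: suffix_det_def trans_wt_def)
  next
    case (Suc r)
    have "{D. D \<subseteq># M \<and> size D < Suc r} =
        {D. D \<subseteq># M \<and> size D < r} \<union> {D. D \<subseteq># M \<and> size D = r}"
      by auto
    moreover have "finite {D. D \<subseteq># M \<and> size D < r}" "finite {D. D \<subseteq># M \<and> size D = r}"
      by (auto intro: finite_subset[OF _ finite_submultisets[of M]])
    ultimately have "prod F {D. D \<subseteq># M \<and> size D < Suc r} =
        prod F {D. D \<subseteq># M \<and> size D < r} * prod F {D. D \<subseteq># M \<and> size D = r}"
      by (simp only:) (rule prod.union_disjoint, auto)
    then show ?case
      using Suc by (simp add: suffix_det_Suc F_def mult.assoc)
  qed
  from this[of "size M"] have "word_det z y M =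
      (z - sum y (elems M)) * prod F {D. D \<subseteq># M \<and> size D < size M}"
    by (simp add: word_det_def suffix_det_def suffixes_size)
  moreover have "{D. D \<subseteq># M \<and> size D < size M} = {D. D \<subset># M}"
    by (auto simp: subset_mset.less_le mset_subset_size dest: mset_subset_size)
  ultimately show ?thesis
    by (simp add: F_def)
qed

section \<open>Closed product form from the recursion\<close>

lemma sum_proper_submultisets_shift:
  assumes "F \<subset># M"
  shows "(\<Sum>D\<in>{D. F \<subseteq># D \<and> D \<subset># M}. h (D - F) (M - D)) =
    (\<Sum>D\<in>{D. D \<subset># M - F}. h D (M - F - D))"
proof (rule sum.reindex_bij_witness[of _ "\<lambda>D. F + D" "\<lambda>D. D - F"])
  fix D assume "D \<in> {D. F \<subseteq># D \<and> D \<subset># M}"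
  then obtain E where E: "D = F + E" and "F + E \<subset># M"
    by (auto simp: mset_subset_eq_exists_conv)
  then obtain G where "M = F + E + G" "G \<noteq> {#}"
    by (auto simp: subset_mset.lessE mset_subset_eq_exists_conv subset_mset.less_le)
  with E show "F + (D - F) = D" "D - F \<in> {D. D \<subset># M - F}"
    "h (D - F) (M - F - (D - F)) = h (D - F) (M - D)"
    by (auto simp: subset_mset.less_le)
next
  fix D assume "D \<in> {D. D \<subset># M - F}"
  then have "D \<subset># M - F" by simp
  moreover obtain G where "M = F + G"
    using assms by (auto simp: mset_subset_eq_exists_conv subset_mset.less_le)
  ultimately show "F + D - F = D" "F + D \<in> {D. F \<subseteq># D \<and> D \<subset># M}"
    by auto
qed

text \<open>The factor of F enters through every D with F contained in D and D properly contained in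
  M, with exponent g(D - F) (b(M, D) - 1). Shifting by F turns the sum of these exponents into the
  recursion for g(M - F).\<close>

lemma word_det_factorization:
  fixes g :: "'b multiset \<Rightarrow> nat"
  assumes g0: "g {#} = 1"
    and g: "\<And>M. M \<noteq> {#} \<Longrightarrow> g M = (\<Sum>D\<in>{D. D \<subset># M}. g D * (card (set_mset (M - D)) - 1))"
  shows "word_det z y M = (\<Prod>D\<in>{D. D \<subseteq># M}. (z - sum y (elems D)) ^ g (M - D))"
proof (induction M rule: measure_induct_rule[where f = size])
  case (less M)
  let ?P = "{D. D \<subset># M}"
  let ?f = "\<lambda>D. z - sum y (elems D)"
  let ?e = "\<lambda>D. card (set_mset (M - D)) - 1"
  have fin: "finite ?P" "finite {D. D \<subseteq># D'}" for D'
    by (auto intro: finite_subset[OF _ finite_submultisets[of M]])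
  have "(\<Prod>D\<in>?P. word_det z y D ^ ?e D) =
      (\<Prod>D\<in>?P. \<Prod>F | F \<in> ?P \<and> F \<subseteq># D. ?f F ^ (g (D - F) * ?e D))"
  proof (rule prod.cong[OF refl])
    fix D assume D: "D \<in> ?P"
    then have "word_det z y D ^ ?e D = (\<Prod>F\<in>{F. F \<subseteq># D}. ?f F ^ g (D - F)) ^ ?e D"
      using less mset_subset_size[of D M] by simp
    also have "\<dots> = (\<Prod>F | F \<in> ?P \<and> F \<subseteq># D. ?f F ^ (g (D - F) * ?e D))"
      unfolding prod_power_distrib power_mult
      using D by (intro prod.cong) (auto intro: subset_mset.le_less_trans)
    finally show "word_det z y D ^ ?e D = \<dots>" .
  qed
  also have "\<dots> = (\<Prod>F\<in>?P. \<Prod>D | D \<in> ?P \<and> F \<subseteq># D. ?f F ^ (g (D - F) * ?e D))"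
    using fin(1) by (rule prod.swap_restrict) (rule fin)
  also have "\<dots> = (\<Prod>F\<in>?P. ?f F ^ g (M - F))"
  proof (rule prod.cong[OF refl])
    fix F assume F: "F \<in> ?P"
    then have "M - F \<noteq> {#}"
      by (auto simp: subset_mset.less_le Diff_eq_empty_iff_mset)
    then have "g (M - F) = (\<Sum>D | D \<in> ?P \<and> F \<subseteq># D. g (D - F) * ?e D)"
      using F sum_proper_submultisets_shift[of F M "\<lambda>D E. g D * (card (set_mset E) - 1)"]
      by (simp add: g conj_commute)
    then show "(\<Prod>D | D \<in> ?P \<and> F \<subseteq># D. ?f F ^ (g (D - F) * ?e D)) = ?f F ^ g (M - F)"
      by (simp add: power_sum)
  qed
  finally have "word_det z y M = ?f M * (\<Prod>F\<in>?P. ?f F ^ g (M - F))"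
    by (simp add: word_det_rec[of z y M])
  moreover have "{D. D \<subseteq># M} = insert M ?P"
    by (auto simp: subset_mset.le_less)
  ultimately show ?case
    using fin(1) g0 by simp
qed

subsection \<open>Counting derangements\<close>

text \<open>If N counts the letters smaller than c, a fixed point in chain c is an occurrence
  of c preceded by exactly N letters different from c. All places at which a further c may be
  inserted as a fixed point lie in a single run of the letter c, so they give the same word.\<close>

fun has_fix :: "'b \<Rightarrow> nat \<Rightarrow> 'b list \<Rightarrow> bool" where
  "has_fix c N [] = False"
| "has_fix c N (b # w) = (if b = c then N = 0 \<or> has_fix c N w else 0 < N \<and> has_fix c (N - 1) w)"

text \<open>Of the places preceded by N letters other than c, the leftmost is used. If there are too
  few such letters, c goes to the end, a default that \<open>has_fix_ins\<close> excludes.\<close>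

fun ins :: "'b \<Rightarrow> nat \<Rightarrow> 'b list \<Rightarrow> 'b list" where
  "ins c 0 w = c # w"
| "ins c (Suc N) [] = [c]"
| "ins c (Suc N) (b # w) = b # ins c (if b = c then Suc N else N) w"

lemma mset_ins [simp]: "mset (ins c N w) = add_mset c (mset w)"
  by (induction c N w rule: ins.induct) auto

lemma ins_inj: "ins c N w = ins c N w' \<Longrightarrow> w = w'"
proof (induction c N w arbitrary: w' rule: ins.induct)
  case (2 c N)
  then have "mset (ins c (Suc N) w') = {#c#}"
    by (metis ins.simps(2) mset_single_iff)
  then show ?case by simp
next
  case (3 c N b w)
  from arg_cong[OF 3(2), of mset] obtain b' v where "w' = b' # v"
    by (cases w') auto
  with 3 show ?case by (auto split: if_splits)
qed simp

lemma has_fix_imp_in_set: "has_fix c N w \<Longrightarrow> c \<in> set w"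
  by (induction c N w rule: has_fix.induct) (auto split: if_splits)

text \<open>The hypothesis says that w has at least N letters other than c, so the inserted copy
  really has N of them before it.\<close>

lemma has_fix_ins:
  "N + count (mset w) c \<le> length w \<Longrightarrow> has_fix c N (ins c N w)"
proof (induction c N w rule: ins.induct)
  case (3 c N b w)
  then show ?case by (auto split: if_splits)
qed (auto simp: count_mset_0_iff)

text \<open>A fixed point lies in a run of c preceded by N other letters, and deleting one c of this
  run undoes the insertion. By \<open>ins_inj\<close> the shorter word is unique.\<close>

lemma has_fix_imp_ins:
  "has_fix c N w \<Longrightarrow> \<exists>w'. w = ins c N w'"
proof (induction w arbitrary: N)
  case (Cons b w)
  show ?case
  proof (cases N)
    case 0
    with Cons.prems have "b # w = ins c N w" by (auto split: if_splits)
    then show ?thesis by blast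
  next
    case (Suc K)
    define N' where "N' = (if b = c then Suc K else K)"
    have "has_fix c N' w"
      using Cons.prems Suc by (auto simp: N'_def split: if_splits)
    then obtain w' where "w = ins c N' w'"
      using Cons.IH by blast
    then have "b # w = ins c N (b # w')"
      by (simp add: Suc N'_def)
    then show ?thesis by blast
  qed
qed simp

text \<open>Of the N' letters before a fixed c' that differ from c', at most
  \<open>count (mset w) c\<close> are c, so at least N letters other than c precede it. The inserted
  c therefore lies to its left and raises its count by one.\<close>

lemma has_fix_ins_later:
  "c' \<noteq> c \<Longrightarrow> N + count (mset w) c \<le> N' \<Longrightarrow> has_fix c' (Suc N') (ins c N w) = has_fix c' N' w"
proof (induction c N w arbitrary: N' rule: ins.induct)
  case (3 c N b w)
  show ?case
  proof (cases "b = c'")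
    case True
    then show ?thesis using 3 by auto
  next
    case False
    with 3 obtain K where "N' = Suc K" by (cases N') auto
    then show ?thesis using False 3 by (auto split: if_splits)
  qed
qed auto

text \<open>A fixed c' has fewer than N letters before it altogether, so the inserted c lies to its
  right.\<close>

lemma has_fix_ins_earlier:
  "c' \<noteq> c \<Longrightarrow> N' + count (mset w) c' \<le> N \<Longrightarrow> has_fix c' N' (ins c N w) = has_fix c' N' w"
proof (induction c N w arbitrary: N' rule: ins.induct)
  case (1 c w)
  then show ?case using has_fix_imp_in_set[of c' N' w] by (auto simp: count_mset_0_iff)
next
  case (3 c N b w)
  then show ?case by (cases N') (auto split: if_splits)
qed auto

section \<open>Removing fixed points chain by chain\<close>

definition below :: "nat multiset \<Rightarrow> nat \<Rightarrow> nat" where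
  "below M c = sum (count M) {..<c}"

lemma below_add_mset: "below (add_mset b M) c = below M c + (if b < c then 1 else 0)"
proof -
  have "below (add_mset b M) c = (\<Sum>a<c. count M a + (if a = b then 1 else 0))"
    unfolding below_def by (intro sum.cong) auto
  then show ?thesis
    by (simp add: below_def sum.distrib)
qed

lemma below_Suc: "below M (Suc c) = below M c + count M c"
  by (simp add: below_def)

lemma below_mono: "c \<le> c' \<Longrightarrow> below M c \<le> below M c'"
  unfolding below_def by (intro sum_mono2) auto

lemma below_le_size: "below M c \<le> size M"
proof -
  have "below M c = (\<Sum>a\<in>{..<c} \<inter> set_mset M. count M a)"
    unfolding below_def by (intro sum.mono_neutral_right) (auto simp: not_in_iff)
  also have "\<dots> \<le> (\<Sum>a\<in>set_mset M. count M a)"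
    by (intro sum_mono2) auto
  finally show ?thesis by (simp add: size_multiset_overloaded_eq)
qed

text \<open>Interpolates between all words, for empty C, and derangements, for \<open>UNIV\<close>,
  so that the chains can be treated one at a time.\<close>

definition fix_free :: "nat set \<Rightarrow> nat multiset \<Rightarrow> nat list set" where
  "fix_free C M = {w \<in> permutations_of_multiset M. \<forall>c\<in>C. \<not> has_fix c (below M c) w}"

lemma finite_fix_free [simp]: "finite (fix_free C M)"
  unfolding fix_free_def by (rule finite_subset[OF _ finite_permutations_of_multiset[of M]]) auto

text \<open>The label intervals of c and c' are disjoint, so one of the two preceding lemmas
  applies. The threshold of c' moves by one exactly when c < c', in step with the letters before a
  fixed c'.\<close>

lemma has_fix_ins_below:
  assumes "c' \<noteq> c" "mset w = M"
  shows "has_fix c' (below (add_mset c M) c') (ins c (below M c) w) = has_fix c' (below M c') w"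
proof (cases "c < c'")
  case True
  then have "below M c + count M c \<le> below M c'"
    using below_mono[of "Suc c" c' M] by (simp add: below_Suc)
  then show ?thesis
    using True assms by (simp add: below_add_mset has_fix_ins_later)
next
  case False
  then have "below M c' + count M c' \<le> below M c"
    using below_mono[of "Suc c'" c M] assms(1) by (simp add: below_Suc)
  then show ?thesis
    using False assms by (simp add: below_add_mset has_fix_ins_earlier)
qed

text \<open>Words with a fixed point in c arise uniquely by inserting one into a word with one c
  less, and the insertion respects fixed points of all other chains. The shorter word may have
  further fixed points in c, hence c must lie outside C.\<close>

lemma card_fix_free_insert:
  assumes "c \<notin> C"
  shows "card (fix_free C M) = card (fix_free (insert c C) M) +
    (if c \<in># M then card (fix_free C (M - {#c#})) else 0)"
proof -
  let ?A = "{w \<in> fix_free C M. has_fix c (below M c) w}"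
  have split: "fix_free C M = fix_free (insert c C) M \<union> ?A"
    by (auto simp: fix_free_def)
  have "card (fix_free C M) = card (fix_free (insert c C) M) + card ?A"
    by (subst arg_cong[OF split, of card], subst card_Un_disjoint) (auto simp: fix_free_def)
  moreover have "card ?A = (if c \<in># M then card (fix_free C (M - {#c#})) else 0)"
  proof (cases "c \<in># M")
    case False
    then have "?A = {}"
      using has_fix_imp_in_set[of c "below M c"] by (auto simp: fix_free_def permutations_of_multiset_def)
    with False show ?thesis by simp
  next
    case True
    define D where "D = M - {#c#}"
    have M: "M = add_mset c D"
      using True by (simp add: D_def)
    have below: "below M c = below D c"
      by (simp add: M below_add_mset)
    have mem: "ins c (below D c) w \<in> fix_free C M \<longleftrightarrow> w \<in> fix_free C D" for w
    proof (cases "mset w = D")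
      case True
      have "has_fix a (below M a) (ins c (below D c) w) = has_fix a (below D a) w" if "a \<in> C" for a
        unfolding M using that assms True by (intro has_fix_ins_below) auto
      then show ?thesis
        using True by (simp add: fix_free_def M permutations_of_multiset_def)
    qed (simp add: fix_free_def M permutations_of_multiset_def)
    have "bij_betw (ins c (below D c)) (fix_free C D) ?A"
      unfolding bij_betw_def
    proof (intro conjI equalityI subsetI)
      show "inj_on (ins c (below D c)) (fix_free C D)"
        by (auto intro!: inj_onI dest: ins_inj)
      fix w assume w: "w \<in> ?A"
      then obtain u where "w = ins c (below D c) u"
        using has_fix_imp_ins[of c "below M c" w] by (auto simp: below)
      then show "w \<in> ins c (below D c) ` fix_free C D"
        using w mem by blast
    next
      fix w assume "w \<in> ins c (below D c) ` fix_free C D"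
      then obtain u where u: "u \<in> fix_free C D" "w = ins c (below D c) u" by blast
      then have "mset u = D"
        by (simp add: fix_free_def permutations_of_multiset_def)
      \<comment> \<open>The smaller letters and all copies of c fit together into u, which leaves
        enough letters other than c for \<open>has_fix_ins\<close>.\<close>
      then have "below D c + count (mset u) c \<le> length u"
        using below_le_size[of D "Suc c"] by (simp add: below_Suc flip: size_mset)
      then show "w \<in> ?A"
        using u mem[of u] has_fix_ins by (simp add: below)
    qed
    then show ?thesis
      using True bij_betw_same_card[of _ "fix_free C D" ?A] by (simp add: D_def)
  qed
  ultimately show ?thesis by simp
qed

definition sub_on :: "nat set \<Rightarrow> nat multiset \<Rightarrow> nat multiset set" where
  "sub_on C M = {D. D \<subseteq># M \<and> (\<forall>c. c \<notin> C \<longrightarrow> count D c = count M c)}"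

lemma finite_sub_on [simp]: "finite (sub_on C M)"
  unfolding sub_on_def by (rule finite_subset[OF _ finite_submultisets[of M]]) auto

text \<open>Iterates \<open>card_fix_free_insert\<close>; f is the number of fixed points in c
  removed before none is left.\<close>

lemma card_fix_free_sum:
  assumes "c \<notin> C"
  shows "card (fix_free C M) = (\<Sum>f\<le>count M c. card (fix_free (insert c C) (M - replicate_mset f c)))"
proof (induction "count M c" arbitrary: M)
  case 0
  then show ?case
    using card_fix_free_insert[OF assms, of M] not_in_iff[of c M] by simp
next
  case (Suc k)
  let ?h = "\<lambda>M. card (fix_free (insert c C) M)"
  define D where "D = M - {#c#}"
  have M: "M = add_mset c D"
    unfolding D_def using Suc(2) by (metis count_greater_zero_iff insert_DiffM zero_less_Suc)
  have "card (fix_free C M) = ?h M + (\<Sum>f\<le>count D c. ?h (D - replicate_mset f c))"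
    using card_fix_free_insert[OF assms, of M] Suc(1)[of D] Suc(2) by (simp add: M)
  also have "\<dots> = ?h M + (\<Sum>f\<le>count D c. ?h (M - replicate_mset (Suc f) c))"
    by (simp add: M)
  also have "\<dots> = (\<Sum>f\<le>Suc (count D c). ?h (M - replicate_mset f c))"
    unfolding sum.atMost_Suc_shift by simp
  finally show ?case
    by (simp add: M)
qed

text \<open>\<open>sub_on C M\<close> lists the contents that can remain after removing fixed points
  in the chains of C. The induction admits one further chain at a time.\<close>

lemma sum_card_fix_free_sub_on:
  assumes "finite C"
  shows "(\<Sum>D\<in>sub_on C M. card (fix_free C D)) = card (permutations_of_multiset M)"
  using assms
proof (induction C rule: finite_induct)
  case empty
  have "sub_on {} M = {M}"
    by (auto simp: sub_on_def intro: multiset_eqI)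
  then show ?case
    by (simp add: fix_free_def)
next
  case (insert c C)
  let ?h = "\<lambda>D. card (fix_free (insert c C) D)"
  have count: "count D c = count M c" if "D \<in> sub_on C M" for D
    using that insert.hyps by (simp add: sub_on_def)
  have "card (permutations_of_multiset M) =
      (\<Sum>D\<in>sub_on C M. \<Sum>f\<le>count M c. ?h (D - replicate_mset f c))"
    unfolding insert.IH[symmetric]
    by (intro sum.cong refl) (simp add: card_fix_free_sum[OF insert.hyps(2)] count)
  also have "\<dots> = (\<Sum>(D, f)\<in>sub_on C M \<times> {..count M c}. ?h (D - replicate_mset f c))"
    by (rule sum.cartesian_product)
  also have "\<dots> = (\<Sum>D\<in>sub_on (insert c C) M. ?h D)"
  \<comment> \<open>The pair belonging to D consists of D with all copies of c restored and the
    number f of copies that were removed.\<close>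
  proof (rule sum.reindex_bij_witness[of _
        "\<lambda>D. (D + replicate_mset (count M c - count D c) c, count M c - count D c)"
        "\<lambda>(D, f). D - replicate_mset f c"])
    fix a assume a: "a \<in> sub_on C M \<times> {..count M c}"
    obtain D f where [simp]: "a = (D, f)" by force
    have D: "D \<subseteq># M" "count D c = count M c" "\<And>b. b \<notin> C \<Longrightarrow> count D b = count M b"
      and f: "f \<le> count M c"
      using a insert.hyps by (auto simp: sub_on_def)
    have "D - replicate_mset f c + replicate_mset f c = D"
      using D f by (simp add: count_le_replicate_mset_subset_eq[symmetric] subset_mset.diff_add)
    then show "(case a of (D, f) \<Rightarrow> D - replicate_mset f c) \<in> sub_on (insert c C) M"
      "((case a of (D, f) \<Rightarrow> D - replicate_mset f c) + replicate_mset
         (count M c - count (case a of (D, f) \<Rightarrow> D - replicate_mset f c) c) c,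
        count M c - count (case a of (D, f) \<Rightarrow> D - replicate_mset f c) c) = a"
      using D f by (auto simp: sub_on_def intro: subset_mset.trans[OF diff_subset_eq_self])
  next
    fix D assume D: "D \<in> sub_on (insert c C) M"
    define f where "f = count M c - count D c"
    have "count D c \<le> count M c"
      using D by (auto simp: sub_on_def intro: mset_subset_eq_count)
    then show "(D + replicate_mset (count M c - count D c) c, count M c - count D c) \<in>
        sub_on C M \<times> {..count M c}"
      using D by (auto simp: sub_on_def subseteq_mset_def)
  qed auto
  finally show ?case by simp
qed

definition derangement_words :: "nat multiset \<Rightarrow> nat list set" where
  "derangement_words M = fix_free UNIV M"

lemma sum_card_derangement_words:
  "(\<Sum>D\<in>{D. D \<subseteq># M}. card (derangement_words D)) = card (permutations_of_multiset M)"
proof -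
  \<comment> \<open>Only letters that occur can be fixed, so the finite set of letters of M may
    replace \<open>UNIV\<close>.\<close>
  have "fix_free (set_mset M) D = derangement_words D" if "D \<subseteq># M" for D
  proof -
    have "\<not> has_fix c N w" if "mset w = D" "c \<notin># M" for c N w
      using that \<open>D \<subseteq># M\<close> has_fix_imp_in_set[of c N w] mset_subset_eqD[of D M c] by auto
    then show ?thesis
      by (auto simp: fix_free_def derangement_words_def permutations_of_multiset_def)
  qed
  moreover have "count D c = count M c" if "D \<subseteq># M" "c \<notin># M" for D c
    using mset_subset_eq_count[OF that(1), of c] that(2) by (simp add: not_in_iff)
  then have "sub_on (set_mset M) M = {D. D \<subseteq># M}"
    unfolding sub_on_def by blast
  ultimately show ?thesis
    using sum_card_fix_free_sub_on[of "set_mset M" M] by simp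
qed

lemma card_permutations_of_multiset_rec:
  assumes "M \<noteq> {#}"
  shows "card (permutations_of_multiset M) = (\<Sum>c\<in>set_mset M. card (permutations_of_multiset (M - {#c#})))"
  unfolding permutations_of_multiset_nonempty[OF assms]
  by (subst card_UN_disjoint) (auto simp: card_image)

text \<open>Apply \<open>sum_card_derangement_words\<close> to M and to each
  \<open>M - {#c#}\<close>. A proper D is contained in \<open>M - {#c#}\<close> exactly for the
  letters c of \<open>M - D\<close>, so counting by first letters meets it b(M, D) times, against
  once on the other side.\<close>

lemma card_derangement_words_rec:
  assumes M: "M \<noteq> {#}"
  shows "card (derangement_words M) =
    (\<Sum>D\<in>{D. D \<subset># M}. card (derangement_words D) * (card (set_mset (M - D)) - 1))"
proof -
  let ?g = "\<lambda>D. card (derangement_words D)"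
  let ?b = "\<lambda>D. card (set_mset (M - D))"
  let ?P = "{D. D \<subset># M}"
  have fin: "finite ?P" "finite {D. D \<subseteq># D'}" for D' :: "nat multiset"
    by (auto intro: finite_subset[OF _ finite_submultisets[of M]])
  have iff: "D \<subseteq># M - {#c#} \<longleftrightarrow> D \<in> ?P \<and> c \<in># M - D" if "c \<in># M" for c D
    using that add_mset_subseteq_iff[of c D M]
    by (auto simp: insert_subset_eq_iff subset_mset.less_le)
  have "{D. D \<subseteq># M} = insert M ?P"
    by (auto simp: subset_mset.le_less)
  then have "?g M + (\<Sum>D\<in>?P. ?g D) = card (permutations_of_multiset M)"
    using fin(1) by (simp add: sum_card_derangement_words[symmetric])
  also have "\<dots> = (\<Sum>c\<in>set_mset M. card (permutations_of_multiset (M - {#c#})))"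
    by (rule card_permutations_of_multiset_rec[OF M])
  also have "\<dots> = (\<Sum>c\<in>set_mset M. \<Sum>D | D \<in> ?P \<and> c \<in># M - D. ?g D)"
    unfolding sum_card_derangement_words[symmetric] by (intro sum.cong) (auto simp: iff)
  also have "\<dots> = (\<Sum>D\<in>?P. \<Sum>c | c \<in> set_mset M \<and> c \<in># M - D. ?g D)"
    using fin(1) by (intro sum.swap_restrict) auto
  also have "\<dots> = (\<Sum>D\<in>?P. ?g D * ?b D)"
  proof (rule sum.cong[OF refl])
    fix D assume "D \<in> ?P"
    have "{c. c \<in> set_mset M \<and> c \<in># M - D} = set_mset (M - D)"
      by (auto dest: in_diffD)
    then show "(\<Sum>c | c \<in> set_mset M \<and> c \<in># M - D. ?g D) = ?g D * ?b D"
      by simp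
  qed
  also have "\<dots> = (\<Sum>D\<in>?P. ?g D * (?b D - 1)) + (\<Sum>D\<in>?P. ?g D)"
    unfolding sum.distrib[symmetric]
  proof (rule sum.cong[OF refl])
    fix D assume "D \<in> ?P"
    then have "set_mset (M - D) \<noteq> {}"
      by (auto simp: subset_mset.less_le Diff_eq_empty_iff_mset)
    then have "?b D \<noteq> 0" by simp
    then show "?g D * ?b D = ?g D * (?b D - 1) + ?g D"
      by (cases "?b D") auto
  qed
  finally show ?thesis by simp
qed

lemma derangement_words_empty [simp]: "derangement_words {#} = {[]}"
  by (auto simp: derangement_words_def fix_free_def)

lemmas word_det_derangements =
  word_det_factorization[of "\<lambda>D. card (derangement_words D)", OF _ card_derangement_words_rec, simplified]

subsection \<open>Linear extensions as words\<close>

definition lab :: "nat multiset \<Rightarrow> nat \<times> nat \<Rightarrow> nat" where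
  "lab M e = below M (Suc (fst e)) - snd e"

text \<open>\<open>chain_lt\<close> read off a multiset of chain lengths, so that passing to a lower
  set becomes subtraction of multisets. A larger second component is further from the top, hence
  smaller in the order.\<close>

definition chain_order :: "nat multiset \<Rightarrow> nat \<Rightarrow> nat \<Rightarrow> bool" where
  "chain_order M a b \<longleftrightarrow> (\<exists>c t t'. t' < t \<and> t < count M c \<and> a = lab M (c, t) \<and> b = lab M (c, t'))"

lemma lab_bounds:
  assumes "(c, t) \<in> elems M"
  shows "below M c < lab M (c, t)" "lab M (c, t) + t = below M (Suc c)"
  using assms by (auto simp: lab_def elems_def below_Suc)

lemma lab_less_iff:
  assumes "(c, t) \<in> elems M" "(c', t') \<in> elems M"
  shows "lab M (c, t) < lab M (c', t') \<longleftrightarrow> c < c' \<or> c = c' \<and> t' < t"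
proof (cases c c' rule: linorder_cases)
  case less
  then show ?thesis
    using lab_bounds[OF assms(1)] lab_bounds[OF assms(2)] below_mono[of "Suc c" c' M] by auto
next
  case greater
  then show ?thesis
    using lab_bounds[OF assms(1)] lab_bounds[OF assms(2)] below_mono[of "Suc c'" c M] by auto
next
  case equal
  then show ?thesis
    using lab_bounds[OF assms(1)] lab_bounds[OF assms(2)] by auto
qed

lemma lab_eq_iff:
  assumes "e \<in> elems M" "e' \<in> elems M"
  shows "lab M e = lab M e' \<longleftrightarrow> e = e'"
proof
  assume "lab M e = lab M e'"
  then show "e = e'"
    using assms lab_less_iff[of "fst e" "snd e" M "fst e'" "snd e'"]
      lab_less_iff[of "fst e'" "snd e'" M "fst e" "snd e"]
    by (auto simp: prod_eq_iff)
qed simp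

lemma bij_betw_lab: "bij_betw (lab M) (elems M) {1..size M}"
proof -
  have inj: "inj_on (lab M) (elems M)"
    by (auto simp: inj_on_def lab_eq_iff)
  have "lab M ` elems M = {1..size M}"
  proof (rule card_subset_eq)
    show "lab M ` elems M \<subseteq> {1..size M}"
    proof clarify
      fix c t assume "(c, t) \<in> elems M"
      from lab_bounds[OF this] show "lab M (c, t) \<in> {1..size M}"
        using below_le_size[of M "Suc c"] by auto
    qed
    show "card (lab M ` elems M) = card {1..size M}"
      using card_image[OF inj] by (simp add: card_elems)
  qed simp
  with inj show ?thesis by (simp add: bij_betw_def)
qed

lemma lab_image: "lab M ` elems M = {1..size M}"
  using bij_betw_lab by (simp add: bij_betw_def)

lemma chain_order_lab:
  assumes "e \<in> elems M" "e' \<in> elems M"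
  shows "chain_order M (lab M e) (lab M e') \<longleftrightarrow> fst e = fst e' \<and> snd e' < snd e"
proof
  assume "chain_order M (lab M e) (lab M e')"
  then obtain c t t' where "t' < t" "t < count M c" "lab M e = lab M (c, t)" "lab M e' = lab M (c, t')"
    by (auto simp: chain_order_def)
  moreover from this have "e = (c, t)" "e' = (c, t')"
    using assms by (simp_all add: lab_eq_iff elems_iff)
  ultimately show "fst e = fst e' \<and> snd e' < snd e" by simp
next
  assume "fst e = fst e' \<and> snd e' < snd e"
  then show "chain_order M (lab M e) (lab M e')"
    unfolding chain_order_def using assms
    by (intro exI[of _ "fst e"] exI[of _ "snd e"] exI[of _ "snd e'"]) (auto simp: elems_def)
qed

lemma chain_order_imp:
  assumes "chain_order M a b"
  shows "a < b" "a \<in> {1..size M}" "b \<in> {1..size M}"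
proof -
  obtain c t t' where *: "t' < t" "t < count M c" "a = lab M (c, t)" "b = lab M (c, t')"
    using assms by (auto simp: chain_order_def)
  then have e: "(c, t) \<in> elems M" "(c, t') \<in> elems M"
    by (auto simp: elems_def)
  with * show "a < b" by (simp add: lab_less_iff)
  show "a \<in> {1..size M}" "b \<in> {1..size M}"
    using e *(3,4) lab_image[of M] by blast+
qed

text \<open>This is standardization: copies of a letter receive increasing labels from left to
  right. A suffix of a word of content M is sent to the suffix of its linear extension, which
  permits the recursion.\<close>

fun std :: "nat multiset \<Rightarrow> nat list \<Rightarrow> nat list" where
  "std M [] = []"
| "std M (c # w) = lab M (c, count (mset w) c) # std M w"

lemma length_std [simp]: "length (std M w) = length w"
  by (induction w) auto

lemma add_mset_subseteqD:
  assumes "add_mset c D \<subseteq># M"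
  shows "D \<subseteq># M" "(c, count D c) \<in> elems M"
  using assms by (auto simp: add_mset_subseteq_iff in_diff_count elems_iff)

lemma set_std: "set (std M w) = lab M ` elems (mset w)"
  by (induction w) (auto simp: elems_add_mset)

lemma distinct_std: "mset w \<subseteq># M \<Longrightarrow> distinct (std M w)"
proof (induction w)
  case (Cons c w)
  then have "add_mset c (mset w) \<subseteq># M" by simp
  note D = add_mset_subseteqD[OF this]
  have "lab M (c, count (mset w) c) \<notin> lab M ` elems (mset w)"
    using D elems_mono[OF D(1)] by (auto simp: lab_eq_iff subset_iff) (auto simp: elems_iff)
  with Cons D show ?case by (simp add: set_std)
qed simp

lemma std_inj:
  "mset w \<subseteq># M \<Longrightarrow> mset w' \<subseteq># M \<Longrightarrow> std M w = std M w' \<Longrightarrow> w = w'"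
proof (induction w arbitrary: w')
  case (Cons c w)
  then obtain d v where w': "w' = d # v"
    by (cases w') auto
  have c: "mset w \<subseteq># M" "(c, count (mset w) c) \<in> elems M"
    and d: "mset v \<subseteq># M" "(d, count (mset v) d) \<in> elems M"
    using Cons.prems add_mset_subseteqD[of c "mset w" M] add_mset_subseteqD[of d "mset v" M]
    by (auto simp: w')
  have "std M w = std M v" "lab M (c, count (mset w) c) = lab M (d, count (mset v) d)"
    using Cons.prems(3) by (simp_all add: w')
  with c d show ?case
    using Cons.IH[of v] by (simp add: w' lab_eq_iff)
next
  case Nil
  then show ?case
    by (cases w') auto
qed

lemma std_nth:
  "j < length w \<Longrightarrow> std M w ! j = lab M (w ! j, count (mset (drop (Suc j) w)) (w ! j))"
proof (induction w arbitrary: j)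
  case (Cons c w)
  then show ?case by (cases j) auto
qed simp

lemma linext_chain_order_iff:
  "p \<in> linext (chain_order M) n \<longleftrightarrow>
    distinct p \<and> set p = {1..n} \<and> sorted_wrt (\<lambda>a b. \<not> chain_order M b a) p"
proof -
  have "(\<forall>i<length p. \<forall>j<length p. chain_order M (p ! i) (p ! j) \<longrightarrow> i < j) \<longleftrightarrow>
      sorted_wrt (\<lambda>a b. \<not> chain_order M b a) p"
    unfolding sorted_wrt_iff_nth_less
  proof (intro iffI allI impI)
    fix i j assume *: "\<forall>i j. i < j \<longrightarrow> j < length p \<longrightarrow> \<not> chain_order M (p ! j) (p ! i)"
      and "i < length p" "j < length p" "chain_order M (p ! i) (p ! j)"
    then show "i < j"
      using chain_order_imp(1)[of M "p ! i" "p ! j"] by (cases i j rule: linorder_cases) auto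
  qed (meson less_asym less_trans)
  then show ?thesis by (auto simp: linext_def)
qed

lemma sorted_std:
  "mset w \<subseteq># M \<Longrightarrow> sorted_wrt (\<lambda>a b. \<not> chain_order M b a) (std M w)"
proof (induction w)
  case (Cons c w)
  then have "add_mset c (mset w) \<subseteq># M" by simp
  note D = add_mset_subseteqD[OF this]
  have "\<not> chain_order M (lab M e) (lab M (c, count (mset w) c))" if "e \<in> elems (mset w)" for e
    using that D elems_mono[OF D(1)] by (cases e) (auto simp: chain_order_lab subset_iff elems_iff)
  with Cons D show ?case by (auto simp: set_std)
qed simp

text \<open>The last hypothesis makes \<open>set q\<close> an upper set. Every suffix of a linear
  extension is one, and sortedness passes the property on to the tail.\<close>

lemma ex_std:
  assumes "set q \<subseteq> {1..size M}" "distinct q" "sorted_wrt (\<lambda>a b. \<not> chain_order M b a) q"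
    and "\<And>a b. a \<in> set q \<Longrightarrow> chain_order M a b \<Longrightarrow> b \<in> set q"
  shows "\<exists>w. mset w \<subseteq># M \<and> std M w = q"
  using assms
proof (induction q)
  case Nil
  show ?case by (rule exI[of _ "[]"]) simp
next
  case (Cons a q)
  have "\<exists>w. mset w \<subseteq># M \<and> std M w = q"
    using Cons.prems by (intro Cons.IH) auto
  then obtain w where w: "mset w \<subseteq># M" "std M w = q" by blast
  have "a \<in> lab M ` elems M"
    using Cons.prems(1) by (simp add: lab_image)
  then obtain c t where a: "a = lab M (c, t)" and ct: "(c, t) \<in> elems M" by auto
  let ?k = "count (mset w) c"
  have "a \<notin> lab M ` elems (mset w)"
    using Cons.prems(2) w by (auto simp: set_std)
  then have "?k \<le> t"
    unfolding a by (metis elems_iff imageI not_less)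
  \<comment> \<open>Otherwise \<open>(c, ?k)\<close> lies above a and so belongs to q, which
    contains only the \<open>?k\<close> topmost elements of chain c.\<close>
  moreover have "\<not> ?k < t"
  proof
    assume "?k < t"
    then have k: "(c, ?k) \<in> elems M"
      using ct by (simp add: elems_iff)
    have "chain_order M a (lab M (c, ?k))"
      unfolding a using ct k \<open>?k < t\<close> by (simp add: chain_order_lab)
    then have "lab M (c, ?k) \<in> set q"
      using Cons.prems(4)[of a "lab M (c, ?k)"] chain_order_imp(1) by fastforce
    then show False
      using k elems_mono[OF w(1)] by (auto simp: set_std lab_eq_iff subset_iff elems_iff simp flip: w(2))
  qed
  ultimately have "t = ?k" by simp
  with ct a w have "mset (c # w) \<subseteq># M \<and> std M (c # w) = a # q"
    by (simp add: add_mset_subseteq_iff in_diff_count elems_iff)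
  then show ?case by blast
qed

lemma bij_betw_std:
  "bij_betw (std M) (permutations_of_multiset M) (linext (chain_order M) (size M))"
  unfolding bij_betw_def
proof (intro conjI equalityI subsetI)
  show "inj_on (std M) (permutations_of_multiset M)"
    by (rule inj_onI, rule std_inj[of _ M]) (simp_all add: permutations_of_multiset_def)
  fix p assume "p \<in> std M ` permutations_of_multiset M"
  then obtain w where "mset w = M" "p = std M w"
    by (auto simp: permutations_of_multiset_def)
  then show "p \<in> linext (chain_order M) (size M)"
    by (simp add: linext_chain_order_iff set_std lab_image distinct_std sorted_std)
next
  fix p assume "p \<in> linext (chain_order M) (size M)"
  then have p: "distinct p" "set p = {1..size M}" "sorted_wrt (\<lambda>a b. \<not> chain_order M b a) p"
    by (auto simp: linext_chain_order_iff)
  have "\<exists>w. mset w \<subseteq># M \<and> std M w = p"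
  proof (rule ex_std)
    show "b \<in> set p" if "chain_order M a b" for a b
      unfolding p(2) by (rule chain_order_imp(3)[OF that])
  qed (use p in simp_all)
  then obtain w where w: "mset w \<subseteq># M" "std M w = p" by blast
  have "length w = size M"
    using p(1,2) distinct_card[of p] length_std[of M w] w(2) by simp
  with w(1) have "w \<in> suffixes M (size M)"
    by (simp add: suffixes_def)
  then have "w \<in> permutations_of_multiset M"
    by (simp only: suffixes_size)
  with w show "p \<in> std M ` permutations_of_multiset M" by blast
qed

section \<open>Promotion and the transition matrix in terms of words\<close>

lemma length_tau [simp]: "length (tau lt i p) = length p"
  by (simp add: tau_def)

lemma tau_Cons: "1 \<le> i \<Longrightarrow> tau lt (Suc i) (b # q) = b # tau lt i q"
  by (cases i) (auto simp: tau_def)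

lemma promo_Cons:
  assumes "1 \<le> j"
  shows "promo lt (Suc j) (b # q) = b # promo lt j q"
proof -
  have "foldl (\<lambda>p i. tau lt i p) (b # q) (map Suc is) = b # foldl (\<lambda>p i. tau lt i p) q is"
    if "\<forall>i\<in>set is. 1 \<le> i" for "is" :: "nat list"
    using that by (induction "is" arbitrary: q) (auto simp: tau_Cons)
  from this[of "[j..<length q]"] assms show ?thesis
    by (simp add: promo_def map_Suc_upt del: upt_Suc)
qed

lemma promo_1_single: "promo lt (Suc 0) [a] = [a]"
  by (simp add: promo_def)

lemma promo_1_Cons_Cons:
  "promo lt (Suc 0) (a # b # q) =
    (if \<not> lt a b \<and> \<not> lt b a then b # promo lt (Suc 0) (a # q) else a # promo lt (Suc 0) (b # q))"
proof -
  have "promo lt (Suc 0) (a # b # q) = promo lt (Suc (Suc 0)) (tau lt (Suc 0) (a # b # q))"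
    unfolding promo_def by (subst upt_conv_Cons) (auto simp del: upt_Suc)
  then show ?thesis
    by (simp add: tau_def promo_Cons)
qed

text \<open>The first element slides past elements of other chains; on meeting the next one of its
  own chain it stops and that one slides on. Both carry the same letter, so in the word the first
  letter just moves to the end.\<close>

lemma promo_1_std:
  "mset (c # w) \<subseteq># M \<Longrightarrow> promo (chain_order M) (Suc 0) (std M (c # w)) = std M (w @ [c])"
proof (induction w)
  case Nil
  then show ?case by (simp add: promo_1_single)
next
  case (Cons d w)
  have c: "(c, count (mset (d # w)) c) \<in> elems M" and dw: "add_mset d (mset w) \<subseteq># M"
    using Cons.prems by (auto dest: add_mset_subseteqD)
  have d: "(d, count (mset w) d) \<in> elems M"
    using add_mset_subseteqD[OF dw] by simp
  have "mset (c # w) \<subseteq># M"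
    using Cons.prems add_mset_subseteqD(1)[of d "mset (c # w)" M] by (simp add: add_mset_commute)
  note IH = Cons.IH[OF this]
  show ?case
  proof (cases "c = d")
    case True
    with c d IH show ?thesis
      by (simp add: promo_1_Cons_Cons chain_order_lab)
  next
    case False
    with c d IH show ?thesis
      by (simp add: promo_1_Cons_Cons chain_order_lab)
  qed
qed

text \<open>Positions are traded for the elements standing there. The function h is arbitrary
  because the induction absorbs into it the leading label, which promotion at later positions leaves
  in place.\<close>

lemma sum_promo_std:
  assumes "mset w \<subseteq># M"
  shows "(\<Sum>j<length w. h (std M w ! j) (promo (chain_order M) (Suc j) (std M w))) =
    (\<Sum>e\<in>elems (mset w). h (lab M e) (std M (act e w)))"
  using assms
proof (induction w arbitrary: h)
  case (Cons b u)
  let ?k = "count (mset u) b"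
  let ?p = "promo (chain_order M)"
  have u: "mset u \<subseteq># M"
    using Cons.prems by (auto dest: add_mset_subseteqD)
  have "(\<Sum>j<length (b # u). h (std M (b # u) ! j) (?p (Suc j) (std M (b # u)))) =
      h (lab M (b, ?k)) (std M (u @ [b])) +
      (\<Sum>j<length u. h (std M u ! j) (lab M (b, ?k) # ?p (Suc j) (std M u)))"
    using promo_1_std[OF Cons.prems]
    by (simp add: sum.lessThan_Suc_shift promo_Cons del: sum.lessThan_Suc)
  also have "(\<Sum>j<length u. h (std M u ! j) (lab M (b, ?k) # ?p (Suc j) (std M u))) =
      (\<Sum>e\<in>elems (mset u). h (lab M e) (lab M (b, ?k) # std M (act e u)))"
    using Cons.IH[OF u, of "\<lambda>a q. h a (lab M (b, ?k) # q)"] by simp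
  also have "\<dots> = (\<Sum>e\<in>elems (mset u). h (lab M e) (std M (act e (b # u))))"
    by (intro sum.cong refl) (auto simp: elems_def mset_act)
  finally show ?case
    by (simp add: elems_add_mset) (simp add: elems_iff)
qed simp

text \<open>A linear extension lists every label once, so all edges leaving it together weigh x_[n].
  Minus the weight of its proper edges is thus the weight of its loops minus x_[n].\<close>

lemma promM_std:
  fixes x :: "nat \<Rightarrow> 'a :: comm_ring_1"
  assumes v: "mset v = M" and w: "mset w = M"
  shows "promM (chain_order M) (size M) x (std M v) (std M w) =
    trans_wt (\<lambda>e. x (lab M e)) M v w - (if v = w then sum x {1..size M} else 0)"
proof -
  let ?p = "\<lambda>j. promo (chain_order M) j (std M w)"
  let ?x = "\<lambda>j. x (std M w ! (j - 1))"
  have len: "length w = size M"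
    using w by auto
  have shift: "sum f {1..size M} = (\<Sum>j<length w. f (Suc j))" for f :: "nat \<Rightarrow> 'a"
    by (simp add: len sum.atLeast1_atMost_eq)
  have inj: "std M u = std M u' \<longleftrightarrow> u = u'" if "mset u = M" "mset u' = M" for u u'
    using that std_inj[of u M u'] by auto
  have hit: "(\<Sum>j\<in>{j\<in>{1..size M}. ?p j = std M v}. ?x j) = trans_wt (\<lambda>e. x (lab M e)) M v w"
  proof -
    have "(\<Sum>j\<in>{j\<in>{1..size M}. ?p j = std M v}. ?x j) =
        (\<Sum>j\<in>{1..size M}. if ?p j = std M v then ?x j else 0)"
      by (rule sum.inter_filter) simp
    also have "\<dots> = (\<Sum>j<length w. if ?p (Suc j) = std M v then x (std M w ! j) else 0)"
      unfolding shift diff_Suc_1 ..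
    also have "\<dots> = (\<Sum>e\<in>elems M. if std M (act e w) = std M v then x (lab M e) else 0)"
      using sum_promo_std[of w M "\<lambda>a q. if q = std M v then x a else 0"] w by simp
    also have "\<dots> = trans_wt (\<lambda>e. x (lab M e)) M v w"
      unfolding trans_wt_def
    proof (intro sum.cong refl)
      fix e assume "e \<in> elems M"
      then have "mset (act e w) = M"
        using w by (auto simp: elems_def mset_act)
      then show "(if std M (act e w) = std M v then x (lab M e) else 0) =
          (if act e w = v then x (lab M e) else 0)"
        using v by (simp add: inj)
    qed
    finally show ?thesis .
  qed
  have total: "sum ?x {1..size M} = sum x {1..size M}"
  proof -
    have "sum ?x {1..size M} = (\<Sum>j<length w. x (std M w ! j))"
      unfolding shift by simp
    also have "\<dots> = (\<Sum>e\<in>elems M. x (lab M e))"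
      using sum_promo_std[of w M "\<lambda>a q. x a"] w by simp
    also have "\<dots> = sum x {1..size M}"
      by (rule sum.reindex_bij_betw[OF bij_betw_lab])
    finally show ?thesis .
  qed
  show ?thesis
  proof (cases "v = w")
    case False
    then show ?thesis
      using v w hit by (simp add: promM_def inj)
  next
    case True
    have "sum ?x {1..size M} = (\<Sum>j\<in>{j\<in>{1..size M}. ?p j = std M w}. ?x j) +
        (\<Sum>j\<in>{j\<in>{1..size M}. ?p j \<noteq> std M w}. ?x j)"
      by (subst sum.union_disjoint[symmetric]) (auto intro!: sum.cong)
    then show ?thesis
      using True hit total by (simp add: promM_def algebra_simps)
  qed
qed

lemma sum_const_poly: "(\<Sum>i\<in>A. [:f i:]) = [:sum f A:]"
  by (induction A rule: infinite_finite_induct) auto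

text \<open>The diagonal correction in \<open>promM_std\<close> shifts lambda to lambda + x_[n],
  which is the polynomial passed as z.\<close>

lemma char_poly_promotion_matrix:
  fixes x :: "nat \<Rightarrow> 'a :: comm_ring_1"
  shows "char_poly (promotion_matrix (chain_order M) (size M) x) =
    word_det [:sum x {1..size M}, 1:] (\<lambda>e. [:x (lab M e):]) M"
proof -
  let ?X = "sum x {1..size M}"
  define L where "L = linext (chain_order M) (size M)"
  define Ls where "Ls = sorted_list_of_set L"
  have "finite L"
    using bij_betw_finite[OF bij_betw_std[of M]] by (simp add: L_def)
  then have Ls: "distinct Ls" "set Ls = L"
    by (simp_all add: Ls_def)
  define F where "F q p = (if q = p then [:0, 1:] else 0) - [:promM (chain_order M) (size M) x q p:]" for q p
  have "char_poly_matrix (promotion_matrix (chain_order M) (size M) x) =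
      mat (length Ls) (length Ls) (\<lambda>(i, j). F (Ls ! i) (Ls ! j))"
    using Ls(1) by (intro eq_matI)
      (auto simp: char_poly_matrix_def promotion_matrix_def Let_def L_def[symmetric] Ls_def[symmetric]
        F_def nth_eq_iff_index_eq)
  then have "char_poly (promotion_matrix (chain_order M) (size M) x) = det_set L F"
    using Ls by (simp add: char_poly_def det_set_eq_det_list[of Ls L] det_list_def)
  also have "\<dots> = det_set (permutations_of_multiset M) (\<lambda>v w. F (std M v) (std M w))"
    unfolding L_def by (rule det_set_reindex[OF bij_betw_std]) simp
  also have "\<dots> = word_det [:?X, 1:] (\<lambda>e. [:x (lab M e):]) M"
    unfolding word_det_def
  proof (rule det_set_cong)
    fix v w assume "v \<in> permutations_of_multiset M" "w \<in> permutations_of_multiset M"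
    then have vw: "mset v = M" "mset w = M"
      by (auto simp: permutations_of_multiset_def)
    have "trans_wt (\<lambda>e. [:x (lab M e):]) M v w = [:trans_wt (\<lambda>e. x (lab M e)) M v w:]"
      unfolding trans_wt_def sum_const_poly[symmetric] by (intro sum.cong) auto
    moreover have "std M v = std M w \<longleftrightarrow> v = w"
      using std_inj[of v M w] vw by auto
    ultimately show "F (std M v) (std M w) =
        (if v = w then [:?X, 1:] else 0) - trans_wt (\<lambda>e. [:x (lab M e):]) M v w"
      by (simp add: F_def promM_std[OF vw])
  qed auto
  finally show ?thesis .
qed

section \<open>Fixed points of words and of linear extensions\<close>

lemma has_fix_iff_nth:
  "has_fix c N w \<longleftrightarrow> (\<exists>j<length w. w ! j = c \<and> N + count (mset (take j w)) c = j)"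
proof (induction c N w rule: has_fix.induct)
  case (2 c N b w)
  have le: "count (mset (take j w)) c \<le> j" for j
    using count_le_size[of "mset (take j w)" c] by (auto intro: le_trans)
  have ex: "(\<exists>j<length (b # w). P j) \<longleftrightarrow> P 0 \<or> (\<exists>j<length w. P (Suc j))" for P
    by (auto simp: less_Suc_eq_0_disj)
  show ?case
  proof (cases "b = c")
    case True
    with 2 show ?thesis unfolding ex by simp
  next
    case False
    have "N + count (mset (take j w)) c = Suc j \<longleftrightarrow> 0 < N \<and> N - 1 + count (mset (take j w)) c = j" for j
      using le[of j] by (cases N) auto
    with 2 False show ?thesis unfolding ex by auto
  qed
qed simp

text \<open>A chain is listed in increasing order, so the label at position j is
  \<open>below M c\<close> plus the number of copies of c up to and including this position.
  Including it accounts for \<open>Suc j\<close> against j.\<close>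

lemma std_fixed_point_iff:
  assumes "mset w = M" "j < length w"
  shows "std M w ! j = Suc j \<longleftrightarrow> below M (w ! j) + count (mset (take j w)) (w ! j) = j"
proof -
  let ?c = "w ! j"
  have "mset w = mset (take j w) + add_mset ?c (mset (drop (Suc j) w))"
    using assms(2) by (metis id_take_nth_drop mset.simps(2) mset_append)
  then have "count M ?c = count (mset (take j w)) ?c + Suc (count (mset (drop (Suc j) w)) ?c)"
    using assms(1) by simp
  then show ?thesis
    using assms(2) by (auto simp: std_nth lab_def below_Suc)
qed

lemma card_poset_derangements:
  "card (poset_derangements (chain_order M) (size M)) = card (derangement_words M)"
proof -
  have "bij_betw (std M) (derangement_words M) (poset_derangements (chain_order M) (size M))"
    unfolding bij_betw_def
  proof
    have sub: "derangement_words M \<subseteq> permutations_of_multiset M"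
      by (auto simp: derangement_words_def fix_free_def)
    then show "inj_on (std M) (derangement_words M)"
      using bij_betw_std by (auto simp: bij_betw_def intro: inj_on_subset)
    have iff: "std M w \<in> poset_derangements (chain_order M) (size M) \<longleftrightarrow> w \<in> derangement_words M"
      if "w \<in> permutations_of_multiset M" for w
    proof -
      have w: "mset w = M" "length w = size M"
        using that by (auto simp: permutations_of_multiset_def)
      have "std M w \<in> linext (chain_order M) (size M)"
        using that bij_betw_std[of M] by (auto simp: bij_betw_def)
      then show ?thesis
        using that w std_fixed_point_iff[OF w(1)]
        by (auto simp: poset_derangements_def derangement_words_def fix_free_def has_fix_iff_nth)
    qed
    show "std M ` derangement_words M = poset_derangements (chain_order M) (size M)"
    proof (intro equalityI subsetI)
      fix p assume p: "p \<in> poset_derangements (chain_order M) (size M)"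
      then have "p \<in> std M ` permutations_of_multiset M"
        using bij_betw_std[of M] by (simp add: bij_betw_def poset_derangements_def)
      with p iff show "p \<in> std M ` derangement_words M" by auto
    qed (use sub iff in auto)
  qed
  then show ?thesis
    by (simp add: bij_betw_same_card)
qed

section \<open>Lower sets as complements of top elements\<close>

definition lower_part :: "nat multiset \<Rightarrow> nat multiset \<Rightarrow> nat set" where
  "lower_part M D = lab M ` (elems M - elems D)"

text \<open>Taking the top \<open>count D c\<close> elements off every chain leaves chains of the
  lengths recorded in \<open>M - D\<close>. Chain indices and the relative order of labels survive,
  so the relabelling yields the standard labels again.\<close>

lemma restr_lower_part:
  assumes "D \<subseteq># M"
  shows "card (lower_part M D) = size (M - D)"
    and "restr (chain_order M) (lower_part M D) = chain_order (M - D)"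
proof -
  define M' where "M' = M - D"
  let ?S = "lower_part M D"
  let ?n = "size M'"
  \<comment> \<open>Each remaining element of chain c is closer to the new top by
    \<open>count D c\<close>.\<close>
  let ?\<phi> = "\<lambda>e. (fst e, snd e + count D (fst e))"
  have \<phi>_elems: "?\<phi> ` elems M' = elems M - elems D"
  proof (intro equalityI subsetI)
    fix e assume e: "e \<in> elems M - elems D"
    show "e \<in> ?\<phi> ` elems M'"
      by (rule image_eqI[of _ _ "(fst e, snd e - count D (fst e))"])
        (use e in \<open>auto simp: elems_def M'_def\<close>)
  qed (auto simp: elems_def M'_def)
  \<comment> \<open>\<open>h\<close> takes a label in the smaller poset to the label in M of the
    same element; being strictly increasing, it enumerates \<open>?S\<close> in sorted
    order.\<close>
  define h where "h a = lab M (?\<phi> (inv_into (elems M') (lab M') a))" for a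
  have h: "h (lab M' e) = lab M (?\<phi> e)" if "e \<in> elems M'" for e
    unfolding h_def using that bij_betw_lab[of M'] by (simp add: bij_betw_def)
  have mono: "h a < h b" if ab: "a \<in> {1..?n}" "b \<in> {1..?n}" "a < b" for a b
  proof -
    obtain e e' where e: "e \<in> elems M'" "a = lab M' e" "e' \<in> elems M'" "b = lab M' e'"
      using ab(1,2) unfolding lab_image[symmetric] by blast
    then have "?\<phi> e \<in> elems M" "?\<phi> e' \<in> elems M"
      using \<phi>_elems by blast+
    then show ?thesis
      using ab(3) e lab_less_iff[of "fst e" "snd e" M' "fst e'" "snd e'"]
      by (auto simp: h lab_less_iff)
  qed
  have img: "h ` {1..?n} = ?S"
    unfolding lower_part_def \<phi>_elems[symmetric] lab_image[symmetric] image_image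
    by (intro image_cong refl h)
  have sorted: "sorted_list_of_set ?S = map h [1..<Suc ?n]"
  proof (rule sorted_list_of_set.idem_if_sorted_distinct[of "map h [1..<Suc ?n]", unfolded set_map, THEN trans[rotated]])
    show "sorted_list_of_set ?S = sorted_list_of_set (h ` set [1..<Suc ?n])"
      using img by (simp add: atLeastLessThanSuc_atLeastAtMost del: upt_Suc)
    have "sorted_wrt (<) (map h [1..<Suc ?n])"
      unfolding sorted_wrt_map by (rule sorted_wrt_mono_rel[of _ "(<)"]) (auto intro!: mono simp del: upt_Suc)
    then show "sorted (map h [1..<Suc ?n])" "distinct (map h [1..<Suc ?n])"
      by (auto simp: strict_sorted_iff)
  qed
  show card: "card ?S = size (M - D)"
    using arg_cong[OF sorted, of length] by (simp add: M'_def del: upt_Suc)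
  have nth: "sorted_list_of_set ?S ! (a - 1) = h a" if "a \<in> {1..?n}" for a
    using that by (auto simp: sorted simp del: upt_Suc)
  show "restr (chain_order M) ?S = chain_order (M - D)"
  proof (intro ext)
    fix a b
    show "restr (chain_order M) ?S a b = chain_order (M - D) a b"
    proof (cases "a \<in> {1..?n} \<and> b \<in> {1..?n}")
      case True
      then obtain e e' where e: "e \<in> elems M'" "a = lab M' e" "e' \<in> elems M'" "b = lab M' e'"
        unfolding lab_image[symmetric] by blast
      then have "?\<phi> e \<in> elems M" "?\<phi> e' \<in> elems M"
        using \<phi>_elems by blast+
      then have "chain_order M (h a) (h b) \<longleftrightarrow> chain_order M' a b"
        using e by (auto simp: h chain_order_lab)
      then show ?thesis
        using True card nth by (simp add: restr_def M'_def)
    next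
      case False
      then show ?thesis
        using chain_order_imp[of "M - D" a b] card by (auto simp: restr_def M'_def)
    qed
  qed
qed

text \<open>In each chain T is an initial segment of the naturals, hence given by its length. Since
  t is counted from the top, this says that upper sets have the form \<open>elems D\<close>.\<close>

lemma ex_elems:
  assumes fin: "finite T" and down: "\<And>c t t'. (c, t) \<in> T \<Longrightarrow> t' < t \<Longrightarrow> (c, t') \<in> T"
  shows "\<exists>D. elems D = T"
proof
  define D where "D = image_mset fst (mset_set T)"
  have "{t. (c, t) \<in> T} = {..<count D c}" for c
  proof -
    let ?A = "{t. (c, t) \<in> T}"
    have A: "finite ?A"
      by (rule finite_subset[of _ "snd ` T"]) (use fin in force)+
    have "count D c = card {e \<in> T. fst e = c}"
      using fin by (simp add: D_def count_image_mset vimage_def Int_def conj_commute)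
    also have "\<dots> = card ?A"
      by (rule bij_betw_same_card[of snd]) (force simp: bij_betw_def inj_on_def)
    finally have count: "count D c = card ?A" .
    \<comment> \<open>A member t brings all t + 1 numbers up to t into the set.\<close>
    have "?A \<subseteq> {..<card ?A}"
    proof
      fix t assume "t \<in> ?A"
      then have "{..t} \<subseteq> ?A"
        using down by (auto simp: le_less)
      then have "card {..t} \<le> card ?A"
        using A card_mono by blast
      then show "t \<in> {..<card ?A}" by simp
    qed
    then show ?thesis
      unfolding count by (intro card_subset_eq) auto
  qed
  then show "elems D = T"
    by (fastforce simp: elems_def)
qed

lemma elems_subset_iff: "elems D \<subseteq> elems M \<longleftrightarrow> D \<subseteq># M"
proof
  assume *: "elems D \<subseteq> elems M"
  show "D \<subseteq># M"
  proof (rule mset_subset_eqI)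
    fix c
    have "(c, count M c) \<notin> elems D"
      using * by (auto simp: elems_def)
    then show "count D c \<le> count M c"
      by (simp add: elems_iff)
  qed
qed (rule elems_mono)

text \<open>Nonempty lower sets are the complements of proper upper sets, and the sets
  \<open>elems D\<close> with \<open>D \<subset># M\<close> are exactly those.\<close>

lemma bij_betw_lower_part:
  "bij_betw (lower_part M) {D. D \<subset># M} {S. S \<noteq> {} \<and> lower_set (chain_order M) (size M) S}"
  unfolding bij_betw_def
proof (intro conjI equalityI subsetI)
  have lab_D: "{1..size M} - lower_part M D = lab M ` elems D" if "D \<subset># M" for D
    using elems_mono[OF subset_mset.less_imp_le[OF that]]
    unfolding lab_image[symmetric] lower_part_def by (auto simp: lab_eq_iff subset_iff)
  show "inj_on (lower_part M) {D. D \<subset># M}"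
  proof (rule inj_onI)
    fix D E assume DE: "D \<in> {D. D \<subset># M}" "E \<in> {D. D \<subset># M}" "lower_part M D = lower_part M E"
    then have "lab M ` elems D = lab M ` elems E"
      using lab_D[of D] lab_D[of E] by simp
    then have "elems D = elems E"
      using DE elems_mono[of D M] elems_mono[of E M] bij_betw_lab[of M]
      by (auto simp: bij_betw_def inj_on_image_eq_iff subset_mset.less_le)
    then show "D = E"
      by (simp add: elems_subset_iff[symmetric] subset_mset.order_eq_iff)
  qed
next
  fix S assume "S \<in> lower_part M ` {D. D \<subset># M}"
  then obtain D where D: "D \<subseteq># M" "D \<noteq> M" and S: "S = lower_part M D"
    by (auto simp: subset_mset.less_le)
  have "\<not> elems M \<subseteq> elems D"
    using D by (simp add: elems_subset_iff subset_mset.order_eq_iff)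
  then have "S \<noteq> {}"
    by (auto simp: S lower_part_def)
  moreover have "b \<in> S" if ba: "a \<in> S" "chain_order M b a" for a b
  proof -
    obtain e where e: "e \<in> elems M" "e \<notin> elems D" "a = lab M e"
      using ba(1) by (auto simp: S lower_part_def)
    obtain e' where e': "e' \<in> elems M" "b = lab M e'"
      using chain_order_imp(2)[OF ba(2)] unfolding lab_image[symmetric] by blast
    have "e' \<notin> elems D"
      using ba(2) e e' by (auto simp: chain_order_lab) (auto simp: elems_def)
    with e' show ?thesis by (auto simp: S lower_part_def)
  qed
  moreover have "S \<subseteq> {1..size M}"
    unfolding S lower_part_def lab_image[symmetric] by blast
  ultimately show "S \<in> {S. S \<noteq> {} \<and> lower_set (chain_order M) (size M) S}"
    by (auto simp: lower_set_def)
next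
  fix S assume "S \<in> {S. S \<noteq> {} \<and> lower_set (chain_order M) (size M) S}"
  then have S: "S \<noteq> {}" "S \<subseteq> {1..size M}" "\<And>a b. a \<in> S \<Longrightarrow> chain_order M b a \<Longrightarrow> b \<in> S"
    by (auto simp: lower_set_def)
  have "\<exists>D. elems D = {e \<in> elems M. lab M e \<notin> S}"
  proof (rule ex_elems)
    fix c t t' assume "(c, t) \<in> {e \<in> elems M. lab M e \<notin> S}" "t' < t"
    moreover from this have "(c, t') \<in> elems M"
      by (simp add: elems_def)
    ultimately show "(c, t') \<in> {e \<in> elems M. lab M e \<notin> S}"
      using S(3)[of "lab M (c, t')" "lab M (c, t)"] by (auto simp: chain_order_lab)
  qed simp
  then obtain D where D: "elems D = {e \<in> elems M. lab M e \<notin> S}" by blast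
  have "lower_part M D = lab M ` {e \<in> elems M. lab M e \<in> S}"
    unfolding lower_part_def D by (rule arg_cong[of _ _ "image (lab M)"]) auto
  also have "\<dots> = lab M ` elems M \<inter> S" by auto
  also have "\<dots> = S"
    using S(2) by (auto simp: lab_image)
  finally have lp: "lower_part M D = S" .
  moreover have "D \<subseteq># M"
    using D by (auto simp: elems_subset_iff[symmetric])
  moreover have "D \<noteq> M"
    using lp S(1) by (auto simp: lower_part_def)
  ultimately show "S \<in> lower_part M ` {D. D \<subset># M}"
    by (auto simp: subset_mset.less_le)
qed

lemma num_der_lower_part:
  assumes "D \<subseteq># M"
  shows "num_der (chain_order M) (lower_part M D) = card (derangement_words (M - D))"
  using restr_lower_part[OF assms] by (simp add: num_der_def card_poset_derangements)

lemma sum_lower_part: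
  fixes x :: "nat \<Rightarrow> 'a :: comm_ring_1"
  assumes "D \<subseteq># M"
  shows "sum x (lower_part M D) = sum x {1..size M} - (\<Sum>e\<in>elems D. x (lab M e))"
proof -
  have inj: "inj_on (lab M) (elems M)"
    using bij_betw_lab by (rule bij_betw_imp_inj_on)
  have "sum x (lower_part M D) = (\<Sum>e\<in>elems M - elems D. x (lab M e))"
    unfolding lower_part_def using inj by (simp add: sum.reindex inj_on_subset)
  also have "\<dots> = (\<Sum>e\<in>elems M. x (lab M e)) - (\<Sum>e\<in>elems D. x (lab M e))"
    using elems_mono[OF assms] by (intro sum_diff) auto
  also have "(\<Sum>e\<in>elems M. x (lab M e)) = sum x {1..size M}"
    by (rule sum.reindex_bij_betw[OF bij_betw_lab])
  finally show ?thesis .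
qed

lemma char_poly_chain_order:
  fixes x :: "nat \<Rightarrow> 'a :: comm_ring_1"
  shows "char_poly (promotion_matrix (chain_order M) (size M) x) =
    [:0, 1:] * (\<Prod>S\<in>{S. S \<noteq> {} \<and> lower_set (chain_order M) (size M) S}.
        [:sum x S, 1:] ^ num_der (chain_order M) S)"
proof -
  let ?X = "sum x {1..size M}"
  let ?f = "\<lambda>D. [:?X, 1:] - (\<Sum>e\<in>elems D. [:x (lab M e):])"
  let ?g = "\<lambda>D. card (derangement_words D)"
  have f: "?f D = [:sum x (lower_part M D), 1:]" if "D \<subseteq># M" for D
    by (simp add: sum_const_poly sum_lower_part[OF that])
  have "char_poly (promotion_matrix (chain_order M) (size M) x) = (\<Prod>D\<in>{D. D \<subseteq># M}. ?f D ^ ?g (M - D))"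
    unfolding char_poly_promotion_matrix by (rule word_det_derangements)
  \<comment> \<open>D = M is split off: it stands for the empty lower set, its exponent is one
    because the empty word is a derangement, and it yields the factor lambda.\<close>
  also have "{D. D \<subseteq># M} = insert M {D. D \<subset># M}"
    by (auto simp: subset_mset.le_less)
  also have "(\<Prod>D\<in>insert M {D. D \<subset># M}. ?f D ^ ?g (M - D)) =
      ?f M * (\<Prod>D\<in>{D. D \<subset># M}. ?f D ^ ?g (M - D))"
    using finite_proper_submultisets[of M] by (subst prod.insert) simp_all
  also have "?f M = [:0, 1:]"
    unfolding f[OF subset_mset.order_refl] by (simp add: lower_part_def)
  also have "(\<Prod>D\<in>{D. D \<subset># M}. ?f D ^ ?g (M - D)) =
      (\<Prod>D\<in>{D. D \<subset># M}. [:sum x (lower_part M D), 1:] ^ num_der (chain_order M) (lower_part M D))"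
    by (intro prod.cong refl) (simp only: mem_Collect_eq f num_der_lower_part subset_mset.less_imp_le)
  also have "\<dots> = (\<Prod>S\<in>{S. S \<noteq> {} \<and> lower_set (chain_order M) (size M) S}.
      [:sum x S, 1:] ^ num_der (chain_order M) S)"
    by (rule prod.reindex_bij_betw[OF bij_betw_lower_part])
  finally show ?thesis .
qed

lemma chain_lt_eq_chain_order:
  fixes ns :: "nat list"
  defines "M \<equiv> (\<Sum>i<length ns. replicate_mset (ns ! i) i)"
  shows "chain_lt ns = chain_order M" "sum_list ns = size M"
proof -
  have count: "count M c = (if c < length ns then ns ! c else 0)" for c
    unfolding M_def count_sum by (simp add: if_distrib sum.If_cases)
  have below: "below M c = sum_list (take c ns)" if "c \<le> length ns" for c
    using that by (auto simp: below_def count sum_list_sum_nth atLeast0LessThan intro!: sum.cong)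
  show "sum_list ns = size M"
    by (simp add: M_def size_multiset_sum sum_list_sum_nth atLeast0LessThan)
  show "chain_lt ns = chain_order M"
  proof (intro ext iffI)
    fix a b assume "chain_lt ns a b"
    then obtain i where i: "i < length ns" "below M i < a" "a < b" "b \<le> below M (Suc i)"
      by (auto simp: chain_lt_def below)
    show "chain_order M a b"
      \<comment> \<open>The witnesses are the distances of a and b from the last label of chain
        i.\<close>
      unfolding chain_order_def
      by (rule exI[of _ i], rule exI[of _ "below M (Suc i) - a"], rule exI[of _ "below M (Suc i) - b"])
        (use i in \<open>auto simp: lab_def below_Suc\<close>)
  next
    fix a b assume ab: "chain_order M a b"
    then obtain c t t' where ct: "t' < t" "t < count M c" "a = lab M (c, t)" "b = lab M (c, t')"
      by (auto simp: chain_order_def)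
    then have "(c, t) \<in> elems M" "(c, t') \<in> elems M"
      by (auto simp: elems_def)
    moreover have "c < length ns"
      using ct(2) by (auto simp: count split: if_splits)
    ultimately have "below M c < a \<and> b \<le> below M (Suc c)"
      using ct lab_bounds[of c t M] lab_bounds[of c t' M] by simp
    with \<open>c < length ns\<close> show "chain_lt ns a b"
      unfolding chain_lt_def using chain_order_imp(1)[OF ab] below[of c] below[of "Suc c"]
      by (auto intro!: exI[of _ c])
  qed
qed

text \<open>\<open>char_poly\<close> is det(lambda 1 - M) with \<open>[:0, 1:]\<close> as lambda.
  The weights may come from any commutative ring, in particular from a polynomial ring in which they
  are indeterminates.\<close>

theorem theorem5p4:
  fixes ns :: "nat list" and x :: "nat \<Rightarrow> 'a::comm_ring_1"
  assumes "\<forall>m\<in>set ns. 0 < m"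
  shows "char_poly (promotion_matrix (chain_lt ns) (sum_list ns) x) =
    [:0, 1:] * (\<Prod>S\<in>{S. S \<noteq> {} \<and> lower_set (chain_lt ns) (sum_list ns) S}.
        [:(\<Sum>i\<in>S. x i), 1:] ^ num_der (chain_lt ns) S)"
  unfolding chain_lt_eq_chain_order by (rule char_poly_chain_order)

end
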